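(* Let $\mathbb{Q}(a)\in\mathcal{E}_m(Q_1,2+\varepsilon_1)$ and let $\phi,\psi\in\mathbb{C}$ satisfy $$0<\operatorname{Re}(\phi)<\min\left\{\frac{2\kappa^{(a)}}{\sigma^2\left(2e^{\kappa^{(a)}T}-1\right)},L_J\right\}\quad\text{and}\quad\operatorname{Re}(\psi)<\frac{\beta-\alpha}{\alpha\beta}.$$ Then: (i) The ODE $$\frac{d}{dt}G^{(a)}(t;\phi)-\kappa^{(a)}G^{(a)}(t;\phi)+\tfrac12\sigma^2G^{(a)}(t;\phi)^2=0,\quad G^{(a)}(T;\phi)=\phi,$$ has a unique solution in the interval $[0,T]$, given by $$G^{(a)}(t;\phi)=\frac{2\kappa^{(a)}}{\sigma^2+e^{\kappa^{(a)}(T-t)}\left(\frac{2\kappa^{(a)}}{\phi}-\sigma^2\right)}.$$ (ii) $\sup_{t\in[0,T]}\operatorname{Re}(G^{(a)}(t;\phi))=\operatorname{Re}(\phi)$. (iii) $\sup_{t\in[0,T]}\mathbb{E}\left[e^{\eta\operatorname{Re}(G^{(a)}(t;\phi))J_1}\right]<\frac\beta\alpha\exp\left(\frac\alpha\beta-1\right)$. In particular, $\left|\mathbb{E}\left[e^{\eta G^{(a)}(t;\phi)J_1}\right]\right|<\infty$ for all $t\in[0,T]$. (iv) The ODE $$\frac{d}{dt}H^{(a)}(t;\phi,\psi)-\beta H^{(a)}(t;\phi,\psi)+e^{\alpha H^{(a)}(t;\phi,\psi)}\mathbb{E}\left[e^{\eta G^{(a)}(t;\phi)J_1}\right]-1=0,\quad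 H^{(a)}(T;\phi,\psi)=\psi,$$ has a unique solution in $[0,T]$. (v) The ODE $$\frac{d}{dt}F^{(a)}(t;\phi,\psi)+\kappa^{(a)}\bar v^{(a)}G^{(a)}(t;\phi)+\beta\lambda_0H^{(a)}(t;\phi,\psi)=0,\quad F^{(a)}(T;\phi,\psi)=0,$$ has a unique solution in $[0,T]$.
   Context: Model. Fix a time horizon $T>0$. On a complete probability space $(\Omega,\mathcal{A},\mathbb{P})$ let $(B,W)$ be a standard two-dimensional Brownian motion on $[0,T]$, $N$ a Hawkes process on $[0,T]$ with stochastic intensity $\lambda_t=\lambda_0+\alpha\int_0^te^{-\beta(t-s)}dN_s$ (equivalently $d\lambda_t=-\beta(\lambda_t-\lambda_0)dt+\alpha\,dN_t$), with $\lambda_0>0$, $\beta>0$, $\alpha\in(0,\beta)$, and $\{J_i\}_{i\ge1}$ i.i.d. strictly positive integrable random variables; $(B,W)$, $N$, $\{J_i\}$ are independent of each other. Put $L_t=\sum_{i=1}^{N_t}J_i$. Assume there is $\epsilon_J>0$ such that $M_J(t)=\mathbb{E}[e^{tJ_1}]$ is finite on $(-\infty,\epsilon_J)$ and $\lim_{t\to\epsilon_J^-}M_J(t)=\infty$. Let $\mathcal{F}_t=\mathcal{F}^{(B,W)}_t\vee\mathcal{F}^L_t$ (minimally augmented filtrations generated by $(B,W)$ and $L$). The interest rate $r$ is constant. The stock $S$ and its variance $v$ satisfy $$\frac{dS_t}{S_t}=\mu_tdt+\sqrt{v_t}\left(\sqrt{1-\rho^2}\,dB_t+\rho\,dW_t\right),\qquad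 dv_t=-\kappa(v_t-\bar v)dt+\sigma\sqrt{v_t}\,dW_t+\eta\,dL_t,$$ with $S_0,v_0,\kappa,\bar v,\sigma,\eta>0$, $\mu:[0,T]\to\mathbb{R}$ bounded measurable deterministic, $\rho\in(-1,1)$, and $2\kappa\bar v\ge\sigma^2$ (the variance equation has a pathwise unique strong solution, which is strictly positive). Measures. For $c\le\frac{\kappa^2}{2\sigma^2}$ let $D(c)=\sqrt{\kappa^2-2\sigma^2c}$ and $\Lambda(c)=\frac{2\eta c(e^{D(c)T}-1)}{D(c)-\kappa+(D(c)+\kappa)e^{D(c)T}}$ (read as its limit when $D(c)=0$), and $$c_l=\sup\left\{c\le\tfrac{\kappa^2}{2\sigma^2}:\ \Lambda(c)<\epsilon_J\ \text{and}\ M_J(\Lambda(c))\le\tfrac{\beta}{\alpha}e^{\frac{\alpha}{\beta}-1}\right\}>0.$$ Let $D=\sup_{t\in[0,T]}(\mu_t-r)^2$ and fix $\varepsilon_1,\varepsilon_2>0$. Assume: $\rho^2<c_l$; $\frac{1-\rho^2}{D[(2+\varepsilon_1)^2-(2+\varepsilon_1)]}\left(\frac{2\kappa\bar v-\sigma^2}{2\sigma}\right)^2>1$; $2\kappa\bar v>(1+\varepsilon_2)\sigma^2$. Fix $Q_2$ with $1<Q_2<\frac{1-\rho^2}{D[(2+\varepsilon_1)^2-(2+\varepsilon_1)]}\left(\frac{2\kappa\bar v-\sigma^2}{2\sigma}\right)^2$ and set $Q_1=\frac{Q_2}{Q_2-1}$. For $a\in\mathbb{R}$ let $\theta^{(a)}_t=\frac{1}{\sqrt{1-\rho^2}}\left(\frac{\mu_t-r}{\sqrt{v_t}}-a\rho\sqrt{v_t}\right)$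 and $$X^{(a)}_t=\exp\left(-\int_0^t\theta^{(a)}_udB_u-\tfrac12\int_0^t(\theta^{(a)}_u)^2du-a\int_0^t\sqrt{v_u}\,dW_u-\tfrac12a^2\int_0^tv_udu\right).$$ $\mathbb{Q}(a)$ is the measure with $\frac{d\mathbb{Q}(a)}{d\mathbb{P}}=X^{(a)}_T$ (an equivalent martingale measure for the values of $a$ used). For $q,s>1$, $\mathcal{E}_m(q,s)$ is the set of $\mathbb{Q}(a)$ with $|a|<\min\left\{\frac{\sqrt{2c_l}}{2},\sqrt{c_l-\rho^2}\right\}$ and $|a|<\min\left\{\frac{1}{qs}\sqrt{\frac{c_l}{2}},\sqrt{\frac{(1-\rho^2)c_l}{qs[2qs(1-\rho^2)+\rho^2s-1]}}\right\}$. Put $\kappa^{(a)}=\kappa+a\sigma>0$, $\bar v^{(a)}=\frac{\kappa\bar v}{\kappa+a\sigma}>0$. $\mathbb{E}$ denotes expectation under $\mathbb{P}$. Constant. $L_J=\frac1\eta M_J^{-1}\left(\frac\beta\alpha\exp\left(\frac\alpha\beta-1\right)\right)>0$, where $M_J^{-1}$ is the inverse function of $M_J$. Solutions of the ODEs are complex-valued functions of the real variable $t$. *)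

theory Defs
  imports "HOL-Probability.Probability" "HOL-Real_Asymp.Real_Asymp"
begin

definition gen_sigma :: "'w measure \<Rightarrow> ('i \<Rightarrow> 'w \<Rightarrow> 'b::topological_space) \<Rightarrow> 'i set \<Rightarrow> 'w measure" where
  "gen_sigma M X I = sigma (space M) {X i -` A \<inter> space M | i A. i \<in> I \<and> A \<in> sets borel}"

definition augmented_filtration ::
    "'w measure \<Rightarrow> (real \<Rightarrow> 'w \<Rightarrow> 'b::topological_space) \<Rightarrow> real \<Rightarrow> 'w measure" where
  "augmented_filtration M X t =
     sigma (space M) (sets (gen_sigma M X {0..t}) \<union> null_sets M)"

definition join_filtration :: "(real \<Rightarrow> 'w measure) \<Rightarrow> (real \<Rightarrow> 'w measure) \<Rightarrow> real \<Rightarrow> 'w measure" where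
  "join_filtration F G t = sigma (space (F t)) (sets (F t) \<union> sets (G t))"

definition brownian_motion :: "'w measure \<Rightarrow> real \<Rightarrow> (real \<Rightarrow> 'w \<Rightarrow> real) \<Rightarrow> bool" where
  "brownian_motion M T B \<longleftrightarrow>
     (\<forall>t\<in>{0..T}. B t \<in> borel_measurable M) \<and>
     (AE \<omega> in M. B 0 \<omega> = 0) \<and>
     (AE \<omega> in M. continuous_on {0..T} (\<lambda>t. B t \<omega>)) \<and>
     (\<forall>s t. 0 \<le> s \<and> s < t \<and> t \<le> T \<longrightarrow>
        distributed M lborel (\<lambda>\<omega>. B t \<omega> - B s \<omega>)
          (\<lambda>x. ennreal (normal_density 0 (sqrt (t - s)) x)) \<and>
        prob_space.indep_set M
          (sets (gen_sigma M (\<lambda>_ \<omega>. B t \<omega> - B s \<omega>) (UNIV :: unit set)))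
          (sets (gen_sigma M B {0..s})))"

definition brownian_motion_2d ::
    "'w measure \<Rightarrow> real \<Rightarrow> (real \<Rightarrow> 'w \<Rightarrow> real) \<Rightarrow> (real \<Rightarrow> 'w \<Rightarrow> real) \<Rightarrow> bool" where
  "brownian_motion_2d M T B W \<longleftrightarrow>
     brownian_motion M T B \<and> brownian_motion M T W \<and>
     prob_space.indep_set M (sets (gen_sigma M B {0..T})) (sets (gen_sigma M W {0..T}))"

definition tendsto_0_in_prob :: "'w measure \<Rightarrow> (nat \<Rightarrow> 'w \<Rightarrow> ennreal) \<Rightarrow> bool" where
  "tendsto_0_in_prob M X \<longleftrightarrow>
     (\<forall>k. X k \<in> borel_measurable M) \<and>
     (\<forall>\<epsilon>>0. (\<lambda>k. measure M {\<omega> \<in> space M. X k \<omega> > ennreal \<epsilon>}) \<longlonglongrightarrow> 0)"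

definition cadlag_on :: "real \<Rightarrow> (real \<Rightarrow> real) \<Rightarrow> bool" where
  "cadlag_on T f \<longleftrightarrow>
     (\<forall>t\<in>{0..<T}. (f \<longlongrightarrow> f t) (at_right t)) \<and>
     (\<forall>t\<in>{0<..T}. \<exists>l. (f \<longlongrightarrow> l) (at_left t))"

text \<open>A simple integrand is the sum over \<open>i < n\<close> of
  \<open>\<xi> i\<close> times the indicator of \<open>(p i, p (i + 1)]\<close>.\<close>

definition simple_integrand ::
    "(real \<Rightarrow> 'w measure) \<Rightarrow> real \<Rightarrow> nat \<Rightarrow> (nat \<Rightarrow> real) \<Rightarrow> (nat \<Rightarrow> 'w \<Rightarrow> real) \<Rightarrow> bool" where
  "simple_integrand F T n p \<xi> \<longleftrightarrow>
     (\<forall>i\<le>n. p i \<in> {0..T}) \<and> (\<forall>i<n. p i \<le> p (Suc i)) \<and>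
     (\<forall>i<n. \<xi> i \<in> borel_measurable (F (p i)) \<and> (\<exists>K. \<forall>\<omega>\<in>space (F (p i)). \<bar>\<xi> i \<omega>\<bar> \<le> K))"

definition simple_value ::
    "nat \<Rightarrow> (nat \<Rightarrow> real) \<Rightarrow> (nat \<Rightarrow> 'w \<Rightarrow> real) \<Rightarrow> real \<Rightarrow> 'w \<Rightarrow> real" where
  "simple_value n p \<xi> t \<omega> = (\<Sum>i<n. \<xi> i \<omega> * indicator {p i<..p (Suc i)} t)"

definition simple_integral ::
    "(real \<Rightarrow> 'w \<Rightarrow> real) \<Rightarrow> nat \<Rightarrow> (nat \<Rightarrow> real) \<Rightarrow> (nat \<Rightarrow> 'w \<Rightarrow> real) \<Rightarrow> real \<Rightarrow> 'w \<Rightarrow> real" where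
  "simple_integral W n p \<xi> t \<omega> =
     (\<Sum>i<n. \<xi> i \<omega> * (W (min (p (Suc i)) t) \<omega> - W (min (p i) t) \<omega>))"

text \<open>\<open>ito_integral M F T W H I\<close>: the process \<open>I\<close> is a version of the Ito integral of \<open>H\<close>
  against \<open>W\<close> on \<open>[0,T]\<close>, as the limit, uniformly in time and in probability, of integrals of
  simple integrands that approximate \<open>H\<close> in \<open>L\<^sup>2(dt)\<close> in probability. It determines \<open>I\<close> on
  \<open>[0,T]\<close> up to indistinguishability, and adaptedness and path continuity of \<open>I\<close> follow.\<close>

definition ito_integral ::
    "'w measure \<Rightarrow> (real \<Rightarrow> 'w measure) \<Rightarrow> real \<Rightarrow> (real \<Rightarrow> 'w \<Rightarrow> real) \<Rightarrow>
     (real \<Rightarrow> 'w \<Rightarrow> real) \<Rightarrow> (real \<Rightarrow> 'w \<Rightarrow> real) \<Rightarrow> bool" where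
  "ito_integral M F T W H I \<longleftrightarrow>
     (\<forall>t\<in>{0..T}. H t \<in> borel_measurable (F t)) \<and>
     (AE \<omega> in M. set_borel_measurable lborel {0..T} (\<lambda>t. H t \<omega>)) \<and>
     (\<exists>n p \<xi>.
        (\<forall>k. simple_integrand F T (n k) (p k) (\<xi> k)) \<and>
        tendsto_0_in_prob M (\<lambda>k \<omega>.
          \<integral>\<^sup>+t\<in>{0..T}. ennreal ((simple_value (n k) (p k) (\<xi> k) t \<omega> - H t \<omega>)^2) \<partial>lborel) \<and>
        tendsto_0_in_prob M (\<lambda>k \<omega>.
          SUP t\<in>{0..T}. ennreal \<bar>simple_integral W (n k) (p k) (\<xi> k) t \<omega> - I t \<omega>\<bar>))"

definition jump_time :: "real \<Rightarrow> (real \<Rightarrow> 'w \<Rightarrow> nat) \<Rightarrow> nat \<Rightarrow> 'w \<Rightarrow> real" where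
  "jump_time T N i \<omega> = Inf {s \<in> {0..T}. i \<le> N s \<omega>}"

definition counting_process :: "'w measure \<Rightarrow> real \<Rightarrow> (real \<Rightarrow> 'w \<Rightarrow> nat) \<Rightarrow> bool" where
  "counting_process M T N \<longleftrightarrow>
     (\<forall>t\<in>{0..T}. N t \<in> measurable M borel) \<and>
     (AE \<omega> in M. N 0 \<omega> = 0 \<and> mono_on {0..T} (\<lambda>t. N t \<omega>) \<and>
        (\<forall>t\<in>{0..<T}. eventually (\<lambda>s. N s \<omega> = N t \<omega>) (at_right t)) \<and>
        (\<forall>t\<in>{0<..T}. eventually (\<lambda>s. N t \<omega> \<le> N s \<omega> + 1) (at_left t)))"

text \<open>The integral of \<open>exp (- \<beta> (t - s))\<close> against \<open>dN\<^sub>s\<close> over \<open>[0,t]\<close> is the sum over the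
  jump times up to \<open>t\<close>.\<close>

definition hawkes_intensity ::
    "real \<Rightarrow> real \<Rightarrow> real \<Rightarrow> real \<Rightarrow> (real \<Rightarrow> 'w \<Rightarrow> nat) \<Rightarrow> real \<Rightarrow> 'w \<Rightarrow> real" where
  "hawkes_intensity T lam\<^sub>0 \<alpha> \<beta> N t \<omega> =
     lam\<^sub>0 + \<alpha> * (\<Sum>i=1..N t \<omega>. exp (- \<beta> * (t - jump_time T N i \<omega>)))"

text \<open>Stochastic intensity: \<open>N\<close> minus the time integral of the intensity is a martingale for the
  history of \<open>N\<close>. Both sides are written with nonnegative integrals; integrability of \<open>N\<close>
  (automatic for an exponential kernel and a finite horizon) makes the identity meaningful.\<close>

definition hawkes_process ::
    "'w measure \<Rightarrow> real \<Rightarrow> real \<Rightarrow> real \<Rightarrow> real \<Rightarrow> (real \<Rightarrow> 'w \<Rightarrow> nat) \<Rightarrow> bool" where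
  "hawkes_process M T lam\<^sub>0 \<alpha> \<beta> N \<longleftrightarrow>
     counting_process M T N \<and>
     integrable M (\<lambda>\<omega>. real (N T \<omega>)) \<and>
     (\<forall>s t. 0 \<le> s \<and> s \<le> t \<and> t \<le> T \<longrightarrow> (\<forall>A\<in>sets (gen_sigma M N {0..s}).
        (\<integral>\<^sup>+\<omega>\<in>A. ennreal (real (N t \<omega>) - real (N s \<omega>)) \<partial>M) =
        (\<integral>\<^sup>+\<omega>\<in>A. (\<integral>\<^sup>+u\<in>{s..t}. ennreal (hawkes_intensity T lam\<^sub>0 \<alpha> \<beta> N u \<omega>) \<partial>lborel) \<partial>M)))"

definition compound_process ::
    "(real \<Rightarrow> 'w \<Rightarrow> nat) \<Rightarrow> (nat \<Rightarrow> 'w \<Rightarrow> real) \<Rightarrow> real \<Rightarrow> 'w \<Rightarrow> real" where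
  "compound_process N J t \<omega> = (\<Sum>i=1..N t \<omega>. J i \<omega>)"

definition market_filtration ::
    "'w measure \<Rightarrow> (real \<Rightarrow> 'w \<Rightarrow> real) \<Rightarrow> (real \<Rightarrow> 'w \<Rightarrow> real) \<Rightarrow>
     (real \<Rightarrow> 'w \<Rightarrow> real) \<Rightarrow> real \<Rightarrow> 'w measure" where
  "market_filtration M B W L =
     join_filtration (augmented_filtration M (\<lambda>t \<omega>. (B t \<omega>, W t \<omega>))) (augmented_filtration M L)"

definition variance_process ::
    "'w measure \<Rightarrow> (real \<Rightarrow> 'w measure) \<Rightarrow> real \<Rightarrow> real \<Rightarrow> real \<Rightarrow> real \<Rightarrow> real \<Rightarrow> real \<Rightarrow>
     (real \<Rightarrow> 'w \<Rightarrow> real) \<Rightarrow> (real \<Rightarrow> 'w \<Rightarrow> real) \<Rightarrow> (real \<Rightarrow> 'w \<Rightarrow> real) \<Rightarrow> bool" where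
  "variance_process M F T v\<^sub>0 \<kappa> vbar \<sigma> \<eta> W L v \<longleftrightarrow>
     (\<forall>t\<in>{0..T}. v t \<in> borel_measurable (F t)) \<and>
     (AE \<omega> in M. cadlag_on T (\<lambda>t. v t \<omega>) \<and> (\<forall>t\<in>{0..T}. 0 < v t \<omega>)) \<and>
     (\<exists>I. ito_integral M F T W (\<lambda>t \<omega>. sqrt (v t \<omega>)) I \<and>
       (AE \<omega> in M. \<forall>t\<in>{0..T}.
          v t \<omega> = v\<^sub>0 - \<kappa> * (LINT u:{0..t}|lborel. v u \<omega> - vbar) + \<sigma> * I t \<omega> + \<eta> * L t \<omega>))"

definition stock_process ::
    "'w measure \<Rightarrow> (real \<Rightarrow> 'w measure) \<Rightarrow> real \<Rightarrow> real \<Rightarrow> (real \<Rightarrow> real) \<Rightarrow> real \<Rightarrow>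
     (real \<Rightarrow> 'w \<Rightarrow> real) \<Rightarrow> (real \<Rightarrow> 'w \<Rightarrow> real) \<Rightarrow> (real \<Rightarrow> 'w \<Rightarrow> real) \<Rightarrow>
     (real \<Rightarrow> 'w \<Rightarrow> real) \<Rightarrow> bool" where
  "stock_process M F T S\<^sub>0 \<mu> \<rho> B W v S \<longleftrightarrow>
     (\<forall>t\<in>{0..T}. S t \<in> borel_measurable (F t)) \<and>
     (AE \<omega> in M. continuous_on {0..T} (\<lambda>t. S t \<omega>)) \<and>
     (\<exists>I\<^sub>B I\<^sub>W.
       ito_integral M F T B (\<lambda>t \<omega>. S t \<omega> * sqrt (v t \<omega>)) I\<^sub>B \<and>
       ito_integral M F T W (\<lambda>t \<omega>. S t \<omega> * sqrt (v t \<omega>)) I\<^sub>W \<and>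
       (AE \<omega> in M. \<forall>t\<in>{0..T}.
          S t \<omega> = S\<^sub>0 + (LINT u:{0..t}|lborel. \<mu> u * S u \<omega>)
                    + sqrt (1 - \<rho>^2) * I\<^sub>B t \<omega> + \<rho> * I\<^sub>W t \<omega>))"

definition mgf :: "'w measure \<Rightarrow> ('w \<Rightarrow> real) \<Rightarrow> real \<Rightarrow> real" where
  "mgf M X t = (\<integral>\<omega>. exp (t * X \<omega>) \<partial>M)"

definition D_fun :: "real \<Rightarrow> real \<Rightarrow> real \<Rightarrow> real" where
  "D_fun \<kappa> \<sigma> c = sqrt (\<kappa>^2 - 2 * \<sigma>^2 * c)"

definition Lambda :: "real \<Rightarrow> real \<Rightarrow> real \<Rightarrow> real \<Rightarrow> real \<Rightarrow> real" where
  "Lambda T \<kappa> \<sigma> \<eta> c =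
     (let d = D_fun \<kappa> \<sigma> c in
      if d = 0 then 2 * \<eta> * c * T / (2 + \<kappa> * T)
      else 2 * \<eta> * c * (exp (d * T) - 1) / (d - \<kappa> + (d + \<kappa>) * exp (d * T)))"

text \<open>The value chosen at \<open>d = 0\<close> is the limit.\<close>

lemma Lambda_limit:
  fixes T \<kappa> \<eta> c :: real
  assumes "T > 0" "\<kappa> > 0"
  shows "((\<lambda>d. 2 * \<eta> * c * (exp (d * T) - 1) / (d - \<kappa> + (d + \<kappa>) * exp (d * T)))
           \<longlongrightarrow> 2 * \<eta> * c * T / (2 + \<kappa> * T)) (at_right 0)"
proof -
  have "((\<lambda>d. (exp (d * T) - 1) / (d - \<kappa> + (d + \<kappa>) * exp (d * T)))
           \<longlongrightarrow> T / (2 + \<kappa> * T)) (at_right 0)"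
  proof -
    have 1: "((\<lambda>d. (exp (d * T) - 1) / d) \<longlongrightarrow> T) (at_right 0)"
      using assms by real_asymp
    have 2: "((\<lambda>d. (d - \<kappa> + (d + \<kappa>) * exp (d * T)) / d) \<longlongrightarrow> 2 + \<kappa> * T) (at_right 0)"
    proof -
      have "((\<lambda>d. 1 + exp (d * T) + \<kappa> * ((exp (d * T) - 1) / d)) \<longlongrightarrow> 1 + 1 + \<kappa> * T) (at_right 0)"
        by (intro tendsto_add tendsto_mult 1 tendsto_const) real_asymp
      moreover have "eventually (\<lambda>d. 1 + exp (d * T) + \<kappa> * ((exp (d * T) - 1) / d) =
          (d - \<kappa> + (d + \<kappa>) * exp (d * T)) / d) (at_right 0)"
        unfolding eventually_at_right_field
        by (intro exI[of _ 1]) (auto simp: field_simps)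
      ultimately show ?thesis by (simp add: tendsto_cong)
    qed
    have "2 + \<kappa> * T \<noteq> 0"
      using assms by (smt (verit) mult_pos_pos)
    from tendsto_divide[OF 1 2 this] show ?thesis
      by (rule Lim_transform_eventually)
        (auto simp: eventually_at_right_field intro!: exI[of _ 1])
  qed
  from tendsto_mult[OF tendsto_const[of "2 * \<eta> * c"] this] show ?thesis
    by simp
qed

definition c_l :: "'w measure \<Rightarrow> ('w \<Rightarrow> real) \<Rightarrow> real \<Rightarrow> real \<Rightarrow> real \<Rightarrow> real \<Rightarrow> real \<Rightarrow> real \<Rightarrow> real \<Rightarrow> real"
  where
  "c_l M J\<^sub>1 \<epsilon>\<^sub>J T \<alpha> \<beta> \<kappa> \<sigma> \<eta> =
     Sup {c. c \<le> \<kappa>^2 / (2 * \<sigma>^2) \<and> Lambda T \<kappa> \<sigma> \<eta> c < \<epsilon>\<^sub>J \<and>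
             mgf M J\<^sub>1 (Lambda T \<kappa> \<sigma> \<eta> c) \<le> \<beta> / \<alpha> * exp (\<alpha> / \<beta> - 1)}"

definition theta ::
    "(real \<Rightarrow> real) \<Rightarrow> real \<Rightarrow> real \<Rightarrow> (real \<Rightarrow> 'w \<Rightarrow> real) \<Rightarrow> real \<Rightarrow> real \<Rightarrow> 'w \<Rightarrow> real" where
  "theta \<mu> r \<rho> v a t \<omega> =
     1 / sqrt (1 - \<rho>^2) * ((\<mu> t - r) / sqrt (v t \<omega>) - a * \<rho> * sqrt (v t \<omega>))"

definition density_process ::
    "'w measure \<Rightarrow> (real \<Rightarrow> 'w measure) \<Rightarrow> real \<Rightarrow> (real \<Rightarrow> real) \<Rightarrow> real \<Rightarrow> real \<Rightarrow>
     (real \<Rightarrow> 'w \<Rightarrow> real) \<Rightarrow> (real \<Rightarrow> 'w \<Rightarrow> real) \<Rightarrow> (real \<Rightarrow> 'w \<Rightarrow> real) \<Rightarrow> real \<Rightarrow>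
     (real \<Rightarrow> 'w \<Rightarrow> real) \<Rightarrow> bool" where
  "density_process M F T \<mu> r \<rho> B W v a X \<longleftrightarrow>
     (\<forall>t\<in>{0..T}. X t \<in> borel_measurable (F t)) \<and>
     (\<exists>I\<^sub>B I\<^sub>W.
       ito_integral M F T B (theta \<mu> r \<rho> v a) I\<^sub>B \<and>
       ito_integral M F T W (\<lambda>t \<omega>. sqrt (v t \<omega>)) I\<^sub>W \<and>
       (AE \<omega> in M. \<forall>t\<in>{0..T}.
          X t \<omega> = exp (- I\<^sub>B t \<omega> - 1/2 * (LINT u:{0..t}|lborel. (theta \<mu> r \<rho> v a u \<omega>)^2)
                       - a * I\<^sub>W t \<omega> - 1/2 * a^2 * (LINT u:{0..t}|lborel. v u \<omega>))))"

definition is_Q ::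
    "'w measure \<Rightarrow> (real \<Rightarrow> 'w measure) \<Rightarrow> real \<Rightarrow> (real \<Rightarrow> real) \<Rightarrow> real \<Rightarrow> real \<Rightarrow>
     (real \<Rightarrow> 'w \<Rightarrow> real) \<Rightarrow> (real \<Rightarrow> 'w \<Rightarrow> real) \<Rightarrow> (real \<Rightarrow> 'w \<Rightarrow> real) \<Rightarrow> real \<Rightarrow>
     'w measure \<Rightarrow> bool" where
  "is_Q M F T \<mu> r \<rho> B W v a Q \<longleftrightarrow>
     (\<exists>X. density_process M F T \<mu> r \<rho> B W v a X \<and> Q = density M (\<lambda>\<omega>. ennreal (X T \<omega>)))"

text \<open>The members of the family are recorded together with their parameter, so that
  \<open>(a, Q) \<in> E_m \<dots>\<close> says that \<open>Q\<close> is the measure with parameter \<open>a\<close> and that this \<open>a\<close> obeys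
  the bounds.\<close>

definition E_m ::
    "'w measure \<Rightarrow> (real \<Rightarrow> 'w measure) \<Rightarrow> real \<Rightarrow> (real \<Rightarrow> real) \<Rightarrow> real \<Rightarrow> real \<Rightarrow>
     (real \<Rightarrow> 'w \<Rightarrow> real) \<Rightarrow> (real \<Rightarrow> 'w \<Rightarrow> real) \<Rightarrow> (real \<Rightarrow> 'w \<Rightarrow> real) \<Rightarrow> real \<Rightarrow>
     real \<Rightarrow> real \<Rightarrow> (real \<times> 'w measure) set" where
  "E_m M F T \<mu> r \<rho> B W v cl q s =
     {(a, Q). is_Q M F T \<mu> r \<rho> B W v a Q \<and>
        \<bar>a\<bar> < min (sqrt (2 * cl) / 2) (sqrt (cl - \<rho>^2)) \<and>
        \<bar>a\<bar> < min (1 / (q * s) * sqrt (cl / 2))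
                  (sqrt ((1 - \<rho>^2) * cl / (q * s * (2 * q * s * (1 - \<rho>^2) + \<rho>^2 * s - 1))))}"

definition L_J :: "'w measure \<Rightarrow> ('w \<Rightarrow> real) \<Rightarrow> real \<Rightarrow> real \<Rightarrow> real \<Rightarrow> real \<Rightarrow> real" where
  "L_J M J\<^sub>1 \<epsilon>\<^sub>J \<alpha> \<beta> \<eta> =
     1 / \<eta> * the_inv_into {..<\<epsilon>\<^sub>J} (mgf M J\<^sub>1) (\<beta> / \<alpha> * exp (\<alpha> / \<beta> - 1))"

text \<open>\<open>ode t y y'\<close> is the differential equation, with \<open>y'\<close> standing for the derivative at \<open>t\<close>
  (one-sided at the endpoints).\<close>

definition solves_tvp ::
    "real \<Rightarrow> (real \<Rightarrow> complex \<Rightarrow> complex \<Rightarrow> bool) \<Rightarrow> complex \<Rightarrow> (real \<Rightarrow> complex) \<Rightarrow> bool" where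
  "solves_tvp T ode y\<^sub>T y \<longleftrightarrow>
     (\<forall>t\<in>{0..T}. \<exists>y'. (y has_vector_derivative y') (at t within {0..T}) \<and> ode t (y t) y') \<and>
     y T = y\<^sub>T"

definition unique_solution_tvp ::
    "real \<Rightarrow> (real \<Rightarrow> complex \<Rightarrow> complex \<Rightarrow> bool) \<Rightarrow> complex \<Rightarrow> (real \<Rightarrow> complex) \<Rightarrow> bool" where
  "unique_solution_tvp T ode y\<^sub>T y \<longleftrightarrow>
     solves_tvp T ode y\<^sub>T y \<and>
     (\<forall>z. solves_tvp T ode y\<^sub>T z \<longrightarrow> (\<forall>t\<in>{0..T}. z t = y t))"

definition G_sol :: "real \<Rightarrow> real \<Rightarrow> real \<Rightarrow> complex \<Rightarrow> real \<Rightarrow> complex" where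
  "G_sol T \<kappa>\<^sub>a \<sigma> \<phi> t =
     2 * complex_of_real \<kappa>\<^sub>a /
       (complex_of_real (\<sigma>^2) + complex_of_real (exp (\<kappa>\<^sub>a * (T - t))) *
          (2 * complex_of_real \<kappa>\<^sub>a / \<phi> - complex_of_real (\<sigma>^2)))"

definition ode_G :: "real \<Rightarrow> real \<Rightarrow> real \<Rightarrow> complex \<Rightarrow> complex \<Rightarrow> bool" where
  "ode_G \<kappa>\<^sub>a \<sigma> t y y' \<longleftrightarrow>
     y' - complex_of_real \<kappa>\<^sub>a * y + 1/2 * complex_of_real (\<sigma>^2) * y^2 = 0"

definition ode_H ::
    "'w measure \<Rightarrow> ('w \<Rightarrow> real) \<Rightarrow> real \<Rightarrow> real \<Rightarrow> real \<Rightarrow> (real \<Rightarrow> complex) \<Rightarrow>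
     real \<Rightarrow> complex \<Rightarrow> complex \<Rightarrow> bool" where
  "ode_H M J\<^sub>1 \<alpha> \<beta> \<eta> G t y y' \<longleftrightarrow>
     y' - complex_of_real \<beta> * y
       + exp (complex_of_real \<alpha> * y) *
           (\<integral>\<omega>. exp (complex_of_real \<eta> * G t * complex_of_real (J\<^sub>1 \<omega>)) \<partial>M)
       - 1 = 0"

definition ode_F ::
    "real \<Rightarrow> real \<Rightarrow> real \<Rightarrow> real \<Rightarrow> (real \<Rightarrow> complex) \<Rightarrow> (real \<Rightarrow> complex) \<Rightarrow>
     real \<Rightarrow> complex \<Rightarrow> complex \<Rightarrow> bool" where
  "ode_F \<kappa>\<^sub>a vbar\<^sub>a \<beta> lam\<^sub>0 G H t y y' \<longleftrightarrow>
     y' + complex_of_real (\<kappa>\<^sub>a * vbar\<^sub>a) * G t + complex_of_real (\<beta> * lam\<^sub>0) * H t = 0"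

end

(* Along the flow the solution is G = phi / w with Re w >= 1 and Im phi * Im w <= 0, whence
   Re G <= Re phi. Consequently |E exp (eta G J_1)| stays strictly below the critical value
   beta / alpha * exp (alpha / beta - 1), and for such a coefficient the half-plane
   Re H < 1 / alpha - 1 / beta is invariant under the backward flow of the equation for H, whose
   right-hand side is globally Lipschitz there. *)

theory Submission
  imports Defs
begin

text \<open>The obstacle is the exponential in the equation for H: the right-hand side is only
  locally Lipschitz, and solutions can blow up backwards in time, so a Picard argument alone does
  not reach all of [0,T]. Existence is therefore proved for an equation whose unknown has its real
  part capped inside the exponential; the invariance of the half-plane then shows that the cap never
  acts. The critical value is the maximum over real x of (\<beta> x + 1) exp(-\<alpha> x), attained
  at x = 1/\<alpha> - 1/\<beta>. The bound of Re \<phi> by \<open>L_J\<close> puts the coefficient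
  strictly below this maximum, and the bound on Re \<psi> starts the solution on the correct side of
  the maximiser. Uniqueness needs a separate argument, because a competing solution is not known to
  stay in the half-plane; it is bounded on the compact interval, which is enough. The quotient w =
  \<phi> / G arises because the Riccati equation becomes linear for 1/G. Its nonzero equilibrium 2
  \<kappa> / \<sigma>^2 repels the backward flow, so Re \<phi> has to start below it.\<close>

section \<open>Terminal value problems: uniqueness and global existence\<close>

text \<open>Backward Gronwall estimate: the weight exp(2 C t) makes the squared norm nondecreasing,
  so its zero at the right endpoint forces it to vanish before. The square is used because the norm
  itself is not differentiable at 0.\<close>

lemma vector_ode_zero_terminal:
  fixes w w' :: "real \<Rightarrow> 'a::real_inner"
  assumes deriv: "\<And>t. t \<in> {a..b} \<Longrightarrow> (w has_vector_derivative w' t) (at t within {a..b})"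
    and bound: "\<And>t. t \<in> {a..b} \<Longrightarrow> norm (w' t) \<le> C * norm (w t)"
    and "w b = 0" and t: "t \<in> {a..b}"
  shows "w t = 0"
proof -
  define g where "g = (\<lambda>t. exp (2 * C * t) * (w t \<bullet> w t))"
  define g' where "g' = (\<lambda>t. exp (2 * C * t) * (2 * C * (w t \<bullet> w t) + 2 * (w t \<bullet> w' t)))"
  have g': "(g has_real_derivative g' s) (at s within {a..b})" if s: "s \<in> {a..b}" for s
  proof -
    have "((\<lambda>t. w t \<bullet> w t) has_derivative (\<lambda>h. w s \<bullet> (h *\<^sub>R w' s) + (h *\<^sub>R w' s) \<bullet> w s))
        (at s within {a..b})"
      using deriv[OF s] unfolding has_vector_derivative_def by (intro has_derivative_inner)
    then have "((\<lambda>t. w t \<bullet> w t) has_real_derivative 2 * (w s \<bullet> w' s)) (at s within {a..b})"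
      unfolding has_field_derivative_def
      by (rule has_derivative_eq_rhs) (auto simp: fun_eq_iff inner_commute algebra_simps)
    then show ?thesis
      unfolding g_def g'_def by (auto intro!: derivative_eq_intros simp: algebra_simps)
  qed
  have nonneg: "0 \<le> g' s" if s: "s \<in> {a..b}" for s
  proof -
    have "\<bar>w s \<bullet> w' s\<bar> \<le> norm (w s) * norm (w' s)"
      by (rule Cauchy_Schwarz_ineq2)
    also have "\<dots> \<le> norm (w s) * (C * norm (w s))"
      using bound[OF s] by (intro mult_left_mono) auto
    also have "\<dots> = C * (w s \<bullet> w s)"
      by (simp add: dot_square_norm power2_eq_square)
    finally show ?thesis
      unfolding g'_def by (intro mult_nonneg_nonneg) auto
  qed
  have "g t \<le> g b"
  proof -
    have "\<exists>x\<in>{t..b}. g b - g t = g' x * (b - t)"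
    proof (rule mvt_very_simple)
      fix x assume "t \<le> x" "x \<le> b"
      then have "(g has_real_derivative g' x) (at x within {t..b})"
        using t by (intro DERIV_subset[OF g']) auto
      then show "(g has_derivative (\<lambda>h. g' x * h)) (at x within {t..b})"
        by (simp add: has_field_derivative_def)
    qed (use t in auto)
    then obtain x where x: "x \<in> {t..b}" "g b - g t = g' x * (b - t)"
      by blast
    have "0 \<le> g' x * (b - t)"
      using x(1) t by (intro mult_nonneg_nonneg nonneg) auto
    then show ?thesis
      using x(2) by simp
  qed
  then show ?thesis
    by (simp add: g_def \<open>w b = 0\<close> mult_le_0_iff dot_square_norm)
qed

lemma solves_tvp_continuous_on:
  assumes "solves_tvp T ode y\<^sub>T y"
  shows "continuous_on {0..T} y"
  using assms unfolding solves_tvp_def continuous_on_eq_continuous_within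
  by (blast intro: has_vector_derivative_continuous)

text \<open>Both solutions are continuous on a compact interval, hence lie in one ball
  \<open>cball 0 R\<close>. A Lipschitz constant on that ball, uniform in time, suffices for the
  Gronwall estimate of the difference.\<close>

lemma solves_tvp_unique:
  assumes y: "solves_tvp T ode y\<^sub>T y" and z: "solves_tvp T ode y\<^sub>T z"
    and ode: "\<And>t x x'. ode t x x' \<longleftrightarrow> x' = f t x"
    and lip: "\<And>R. \<exists>C. \<forall>t\<in>{0..T}. C-lipschitz_on (cball 0 R) (f t)"
    and t: "t \<in> {0..T}"
  shows "z t = y t"
proof -
  have "bounded (y ` {0..T} \<union> z ` {0..T})"
    using solves_tvp_continuous_on[OF y] solves_tvp_continuous_on[OF z]
    by (auto intro!: compact_imp_bounded compact_continuous_image)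
  then obtain R where R: "\<And>s. s \<in> {0..T} \<Longrightarrow> norm (y s) \<le> R \<and> norm (z s) \<le> R"
    unfolding bounded_iff by (metis UnI1 UnI2 imageI)
  obtain C where C: "\<And>s. s \<in> {0..T} \<Longrightarrow> C-lipschitz_on (cball 0 R) (f s)"
    using lip by blast
  have "z t - y t = 0"
  proof (rule vector_ode_zero_terminal[where w = "\<lambda>t. z t - y t" and a = 0 and b = T])
    fix s assume s: "s \<in> {0..T}"
    have "(y has_vector_derivative f s (y s)) (at s within {0..T})"
      "(z has_vector_derivative f s (z s)) (at s within {0..T})"
      using y z s by (auto simp: solves_tvp_def ode)
    then show "((\<lambda>t. z t - y t) has_vector_derivative f s (z s) - f s (y s)) (at s within {0..T})"
      by (intro has_vector_derivative_diff)
    show "norm (f s (z s) - f s (y s)) \<le> C * norm (z s - y s)"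
      using lipschitz_onD[OF C[OF s], of "z s" "y s"] R[OF s] by (simp add: dist_norm)
  qed (use y z t in \<open>auto simp: solves_tvp_def\<close>)
  then show ?thesis by simp
qed

text \<open>The weight \<open>exp (K * (b - t))\<close> makes the Picard operator a contraction on the whole
  interval.\<close>

lemma global_lipschitz_terminal_solution:
  fixes f :: "real \<Rightarrow> 'a::banach \<Rightarrow> 'a"
  assumes "a \<le> b"
    and cont: "continuous_on ({a..b} \<times> UNIV) (\<lambda>(t, x). f t x)"
    and lip: "\<And>t. t \<in> {a..b} \<Longrightarrow> L-lipschitz_on UNIV (f t)"
  obtains y where "\<And>t. t \<in> {a..b} \<Longrightarrow> (y has_vector_derivative f t (y t)) (at t within {a..b})"
    and "y b = y\<^sub>b"
proof -
  have "L \<ge> 0"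
    using lip[of a] \<open>a \<le> b\<close> by (auto dest: lipschitz_on_nonneg)
  \<comment> \<open>Any K with L / K at most 1/2 gives a contraction; the added 1 keeps K positive
    when L = 0.\<close>
  define K where "K = 2 * L + 1"
  have "K > 0" using \<open>L \<ge> 0\<close> by (simp add: K_def)
  \<comment> \<open>The fixed point is sought for g(s) = exp(-K (b - s)) y(s), so multiplying by
    exp(K (b - s)) recovers y inside \<open>f\<close>.\<close>
  define \<Phi> where "\<Phi> g s = f s (exp (K * (b - s)) *\<^sub>R apply_bcontfun g s)" for g s
  define I where "I g t = exp (- K * (b - t)) *\<^sub>R (y\<^sub>b - integral {t..b} (\<Phi> g))" for g t
  \<comment> \<open>Elements of the type of bounded continuous functions live on the whole line;
    clamping the argument extends a function on [a,b] by constants.\<close>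
  define cl where "cl t = max a (min b t)" for t
  have cl_in: "cl t \<in> {a..b}" for t using \<open>a \<le> b\<close> by (auto simp: cl_def)
  have cl_id: "cl t = t" if "t \<in> {a..b}" for t using that by (auto simp: cl_def)
  have cl_cont: "continuous_on UNIV cl" unfolding cl_def by (intro continuous_intros)
  have \<Phi>_cont: "continuous_on {a..b} (\<Phi> g)" for g
  proof -
    have "continuous_on {a..b} (\<lambda>s. (\<lambda>(t, x). f t x) (s, exp (K * (b - s)) *\<^sub>R apply_bcontfun g s))"
      by (rule continuous_on_compose2[OF cont]) (auto intro!: continuous_intros)
    then show ?thesis by (simp add: \<Phi>_def[abs_def])
  qed
  have \<Phi>_int: "\<Phi> g integrable_on {t..b}" if "t \<in> {a..b}" for g t
    using that by (intro integrable_continuous_real continuous_on_subset[OF \<Phi>_cont]) auto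
  have I_cont: "continuous_on {a..b} (I g)" for g
  proof -
    have "continuous_on {a..b} (\<lambda>t. integral {t..b} (\<Phi> g))"
      unfolding continuous_on_eq_continuous_within
      using integral_has_vector_derivative'[OF \<Phi>_cont] by (blast intro: has_vector_derivative_continuous)
    then show ?thesis unfolding I_def by (intro continuous_intros)
  qed
  have I_bcont: "(\<lambda>t. I g (cl t)) \<in> bcontfun" for g
  proof -
    have "continuous_on UNIV (\<lambda>t. I g (cl t))"
      by (rule continuous_on_compose2[OF I_cont cl_cont]) (use cl_in in auto)
    moreover have "bounded (I g ` {a..b})"
      by (intro compact_imp_bounded compact_continuous_image I_cont) auto
    then have "bounded (range (\<lambda>t. I g (cl t)))"
      by (rule bounded_subset) (use cl_in in auto)
    ultimately show ?thesis by (simp add: bcontfun_def)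
  qed
  define P where "P g = Bcontfun (\<lambda>t. I g (cl t))" for g
  have P: "apply_bcontfun (P g) t = I g (cl t)" for g t
    unfolding P_def by (simp add: Bcontfun_inverse[OF I_bcont])
  have "\<exists>!g. P g = g"
  proof (rule banach_fix_type)
    have "dist (P g) (P h) \<le> 1 / 2 * dist g h" for g h
    proof (rule dist_bound)
      fix t
      define c where "c = cl t"
      have c: "c \<in> {a..b}" using cl_in by (simp add: c_def)
      define d where "d = dist g h"
      \<comment> \<open>This integral is L d / K (exp(K (b - c)) - 1). The factor exp(-K (b - c)) in
        \<open>I\<close> cancels its growth and leaves at most L d / K.\<close>
      have ex: "((\<lambda>s. L * d * exp (K * (b - s))) has_integral
          (- (L * d / K) * exp (K * (b - b))) - (- (L * d / K) * exp (K * (b - c)))) {c..b}"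
        using c \<open>K > 0\<close>
        by (intro fundamental_theorem_of_calculus)
          (auto intro!: derivative_eq_intros simp flip: has_real_derivative_iff_has_vector_derivative)
      have "norm (integral {c..b} (\<lambda>s. \<Phi> h s - \<Phi> g s)) \<le> integral {c..b} (\<lambda>s. L * d * exp (K * (b - s)))"
      proof (rule integral_norm_bound_integral)
        fix s assume s: "s \<in> {c..b}"
        have "norm (\<Phi> h s - \<Phi> g s) \<le> L * norm (exp (K * (b - s)) *\<^sub>R apply_bcontfun h s - exp (K * (b - s)) *\<^sub>R apply_bcontfun g s)"
          using lipschitz_onD[OF lip, of s] s c by (auto simp: \<Phi>_def dist_norm)
        also have "\<dots> = L * (exp (K * (b - s)) * dist (apply_bcontfun g s) (apply_bcontfun h s))"
          by (simp add: dist_norm norm_minus_commute flip: scaleR_diff_right)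
        also have "\<dots> \<le> L * (exp (K * (b - s)) * d)"
          using \<open>L \<ge> 0\<close> by (intro mult_left_mono) (auto simp: d_def dist_bounded)
        finally show "norm (\<Phi> h s - \<Phi> g s) \<le> L * d * exp (K * (b - s))"
          by (simp add: mult_ac)
      qed (use ex c in \<open>auto intro!: integrable_diff \<Phi>_int\<close>)
      also have "\<dots> = L * d / K * (exp (K * (b - c)) - 1)"
        using integral_unique[OF ex] by (simp add: algebra_simps)
      finally have le: "norm (integral {c..b} (\<lambda>s. \<Phi> h s - \<Phi> g s)) \<le> L * d / K * (exp (K * (b - c)) - 1)" .
      have "dist (I g c) (I h c) = norm (exp (- K * (b - c)) *\<^sub>R (integral {c..b} (\<Phi> h) - integral {c..b} (\<Phi> g)))"
        unfolding I_def dist_norm scaleR_diff_right[symmetric] by simp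
      also have "\<dots> = exp (- K * (b - c)) * norm (integral {c..b} (\<lambda>s. \<Phi> h s - \<Phi> g s))"
        by (simp add: Henstock_Kurzweil_Integration.integral_diff[OF \<Phi>_int[OF c] \<Phi>_int[OF c]])
      also have "\<dots> \<le> exp (- K * (b - c)) * (L * d / K * (exp (K * (b - c)) - 1))"
        using le by (intro mult_left_mono) auto
      also have "\<dots> = L * d / K * (1 - exp (- K * (b - c)))"
        by (simp add: algebra_simps flip: exp_add)
      also have "\<dots> \<le> L * d / K * 1"
        using \<open>L \<ge> 0\<close> \<open>K > 0\<close> by (intro mult_left_mono) (auto simp: d_def)
      also have "\<dots> = L / K * d" by simp
      also have "\<dots> \<le> 1 / 2 * d"
        using \<open>L \<ge> 0\<close> by (intro mult_right_mono) (auto simp: d_def K_def field_simps)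
      finally show "dist (apply_bcontfun (P g) t) (apply_bcontfun (P h) t) \<le> 1 / 2 * dist g h"
        by (simp add: P c_def d_def)
    qed
    then show "\<forall>g h. dist (P g) (P h) \<le> 1 / 2 * dist g h"
      by blast
  qed auto
  then obtain g where g: "P g = g" by blast
  define y where "y t = exp (K * (b - t)) *\<^sub>R apply_bcontfun g t" for t
  have \<Phi>_y: "\<Phi> g = (\<lambda>s. f s (y s))"
    by (simp add: \<Phi>_def y_def fun_eq_iff)
  have y: "y t = y\<^sub>b - integral {t..b} (\<Phi> g)" if t: "t \<in> {a..b}" for t
  proof -
    have "apply_bcontfun g t = I g t"
      using P[of g t] g cl_id[OF t] by simp
    then show ?thesis
      by (simp add: y_def I_def flip: exp_add)
  qed
  show thesis
  proof (rule that[of y])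
    fix t assume t: "t \<in> {a..b}"
    have "((\<lambda>t. y\<^sub>b - integral {t..b} (\<Phi> g)) has_vector_derivative 0 - - \<Phi> g t) (at t within {a..b})"
      by (intro has_vector_derivative_diff integral_has_vector_derivative'[OF \<Phi>_cont t]
          has_vector_derivative_const)
    then have deriv: "((\<lambda>t. y\<^sub>b - integral {t..b} (\<Phi> g)) has_vector_derivative f t (y t)) (at t within {a..b})"
      by (simp add: \<Phi>_y)
    show "(y has_vector_derivative f t (y t)) (at t within {a..b})"
      by (rule has_vector_derivative_transform[OF t _ deriv]) (rule y)
  next
    show "y b = y\<^sub>b" using y[of b] \<open>a \<le> b\<close> by simp
  qed
qed

section \<open>Integrals with a parameter and the moment generating function\<close>

text \<open>Dominated convergence along sequences. The domination is only almost everywhere, because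
  positivity of the jumps holds only almost surely.\<close>

lemma continuous_on_dominated_integral:
  fixes f :: "'b::metric_space \<Rightarrow> 'a \<Rightarrow> 'c::{banach, second_countable_topology}"
  assumes meas: "\<And>x. x \<in> S \<Longrightarrow> f x \<in> borel_measurable M"
    and "integrable M w"
    and dom: "\<And>x. x \<in> S \<Longrightarrow> AE \<omega> in M. norm (f x \<omega>) \<le> w \<omega>"
    and cont: "\<And>\<omega>. \<omega> \<in> space M \<Longrightarrow> continuous_on S (\<lambda>x. f x \<omega>)"
  shows "continuous_on S (\<lambda>x. \<integral>\<omega>. f x \<omega> \<partial>M)"
  unfolding continuous_on_sequentially comp_def
proof (intro allI ballI impI, elim conjE)
  fix X x assume X: "\<forall>n. X n \<in> S" "X \<longlonglongrightarrow> x" and x: "x \<in> S"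
  have "AE \<omega> in M. (\<lambda>n. f (X n) \<omega>) \<longlonglongrightarrow> f x \<omega>"
    using cont X x unfolding continuous_on_sequentially comp_def by (auto intro!: AE_I2)
  then show "(\<lambda>n. \<integral>\<omega>. f (X n) \<omega> \<partial>M) \<longlonglongrightarrow> (\<integral>\<omega>. f x \<omega> \<partial>M)"
    using X x by (intro integral_dominated_convergence[where w = w] assms) auto
qed

text \<open>The derivative exp has modulus exp(Re z), at most exp r here, and the half-plane is
  convex, so the mean value inequality applies.\<close>

lemma lipschitz_on_exp_halfplane:
  "(exp r)-lipschitz_on {z. Re z \<le> r} (exp :: complex \<Rightarrow> complex)"
proof (rule lipschitz_onI)
  fix x y :: complex assume "x \<in> {z. Re z \<le> r}" "y \<in> {z. Re z \<le> r}"
  then show "dist (exp x) (exp y) \<le> exp r * dist x y"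
    unfolding dist_norm
    by (intro field_differentiable_bound[where S = "{z. Re z \<le> r}" and f' = exp])
      (auto simp: convex_halfspace_Re_le intro!: derivative_eq_intros)
qed simp

text \<open>At x = \<alpha>/\<beta> this says that the critical value is at least 1, the value of
  the moment generating function at 0.\<close>

lemma exp_minus_one_ge: "x \<le> exp (x - 1)" for x :: real
  using exp_ge_add_one_self[of "x - 1"] by simp

lemma (in prob_space) mgf_strict_mono:
  assumes "AE \<omega> in M. X \<omega> > 0"
    and "integrable M (\<lambda>\<omega>. exp (s * X \<omega>))" and "integrable M (\<lambda>\<omega>. exp (t * X \<omega>))"
    and "s < t"
  shows "mgf M X s < mgf M X t"
  unfolding mgf_def
proof (rule integral_less_AE_space)
  show "AE \<omega> in M. exp (s * X \<omega>) < exp (t * X \<omega>)"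
    using assms(1) by eventually_elim (use \<open>s < t\<close> in simp)
qed (use assms in \<open>auto simp: emeasure_space_1\<close>)

lemma mgf_continuous_on:
  assumes "X \<in> borel_measurable M" and "AE \<omega> in M. X \<omega> \<ge> 0"
    and "integrable M (\<lambda>\<omega>. exp (u * X \<omega>))"
  shows "continuous_on {..u} (mgf M X)"
proof -
  have "continuous_on {..u} (\<lambda>t. \<integral>\<omega>. exp (t * X \<omega>) \<partial>M)"
  proof (rule continuous_on_dominated_integral[OF _ assms(3)])
    fix t assume t: "t \<in> {..u}"
    show "AE \<omega> in M. norm (exp (t * X \<omega>)) \<le> exp (u * X \<omega>)"
      using assms(2) by eventually_elim (use t in \<open>auto intro: mult_right_mono\<close>)
  qed (use assms(1) in \<open>auto intro!: continuous_intros\<close>)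
  then show ?thesis
    by (simp add: mgf_def[abs_def])
qed

text \<open>\<open>the_inv_into\<close> is meaningful only for an injective function and an attained
  value. Strict monotonicity gives the first; the intermediate value theorem, between the value 1 at
  0 and the blow-up at \<epsilon>, gives the second.\<close>

lemma (in prob_space) mgf_the_inv_into:
  assumes X: "X \<in> borel_measurable M" "AE \<omega> in M. X \<omega> > 0"
    and int: "\<And>t. t < \<epsilon> \<Longrightarrow> integrable M (\<lambda>\<omega>. exp (t * X \<omega>))"
    and lim: "filterlim (mgf M X) at_top (at_left \<epsilon>)"
    and "\<epsilon> > 0" and "y \<ge> 1"
  shows "the_inv_into {..<\<epsilon>} (mgf M X) y < \<epsilon>"
    and "mgf M X (the_inv_into {..<\<epsilon>} (mgf M X) y) = y"
proof -
  have "eventually (\<lambda>t. y \<le> mgf M X t) (at_left \<epsilon>)"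
    using lim by (simp add: filterlim_at_top)
  then obtain b where b: "b < \<epsilon>" "\<And>t. b < t \<Longrightarrow> t < \<epsilon> \<Longrightarrow> y \<le> mgf M X t"
    unfolding eventually_at_left_field by blast
  obtain u where u: "max 0 b < u" "u < \<epsilon>"
    using dense[of "max 0 b" \<epsilon>] b(1) \<open>\<epsilon> > 0\<close> by auto
  have "mgf M X 0 = 1"
    by (simp add: mgf_def prob_space)
  moreover have "continuous_on {0..u} (mgf M X)"
    by (rule continuous_on_subset[OF mgf_continuous_on[OF X(1) _ int[OF u(2)]]]) (use X(2) in auto)
  ultimately obtain t where "t \<le> u" "mgf M X t = y"
    using IVT'[of "mgf M X" 0 y u] u b(2)[of u] \<open>y \<ge> 1\<close> by auto
  with u have t: "t < \<epsilon>" "mgf M X t = y" by auto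
  have "inj_on (mgf M X) {..<\<epsilon>}"
    by (rule linorder_inj_onI) (use mgf_strict_mono[OF X(2) int int] in force)+
  then show "the_inv_into {..<\<epsilon>} (mgf M X) y < \<epsilon>"
    and "mgf M X (the_inv_into {..<\<epsilon>} (mgf M X) y) = y"
    using the_inv_into_into[of "mgf M X" "{..<\<epsilon>}" y "{..<\<epsilon>}"] f_the_inv_into_f[of "mgf M X" "{..<\<epsilon>}" y] t by auto
qed

text \<open>A real \<open>Sup\<close> inherits an upper bound only from a nonempty set; c = 0 is a
  member, since there \<open>Lambda\<close> is 0 and the moment generating function is 1. The bound
  later yields positivity of \<kappa> + a \<sigma>.\<close>

lemma (in prob_space) c_l_le:
  assumes "\<epsilon>\<^sub>J > 0" "\<alpha> > 0" "\<beta> > 0" "\<kappa> > 0"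
  shows "c_l M X \<epsilon>\<^sub>J T \<alpha> \<beta> \<kappa> \<sigma> \<eta> \<le> \<kappa>^2 / (2 * \<sigma>^2)"
  unfolding c_l_def
proof (rule cSup_least)
  have "1 \<le> \<beta> / \<alpha> * exp (\<alpha> / \<beta> - 1)"
    using exp_minus_one_ge[of "\<alpha> / \<beta>"] assms by (simp add: field_simps)
  moreover have "Lambda T \<kappa> \<sigma> \<eta> 0 = 0"
    by (simp add: Lambda_def Let_def)
  ultimately have "0 \<in> {c. c \<le> \<kappa>^2 / (2 * \<sigma>^2) \<and> Lambda T \<kappa> \<sigma> \<eta> c < \<epsilon>\<^sub>J \<and>
      mgf M X (Lambda T \<kappa> \<sigma> \<eta> c) \<le> \<beta> / \<alpha> * exp (\<alpha> / \<beta> - 1)}"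
    using assms by (simp add: mgf_def prob_space)
  then show "{c. c \<le> \<kappa>^2 / (2 * \<sigma>^2) \<and> Lambda T \<kappa> \<sigma> \<eta> c < \<epsilon>\<^sub>J \<and>
      mgf M X (Lambda T \<kappa> \<sigma> \<eta> c) \<le> \<beta> / \<alpha> * exp (\<alpha> / \<beta> - 1)} \<noteq> {}"
    by blast
qed auto

section \<open>The Riccati equation for G\<close>

text \<open>Re w - 1 factors as (E - 1)(1 - \<sigma>^2 Re \<phi> / (2 \<kappa>)), and both factors
  are nonnegative when Re \<phi> is below the equilibrium. As the denominator of
  \<open>G_sol\<close> is a nonzero multiple of w, it cannot vanish.\<close>

lemma G_sol_denominator:
  fixes \<phi> :: complex
  assumes "\<kappa> > 0" "\<sigma> > 0" "0 < Re \<phi>" "Re \<phi> < 2 * \<kappa> / \<sigma>^2" "t \<le> T"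
  defines "E \<equiv> exp (\<kappa> * (T - t))"
  defines "w \<equiv> of_real E - of_real (\<sigma>^2 / (2 * \<kappa>) * (E - 1)) * \<phi>"
  shows "Re w \<ge> 1"
    and "of_real (\<sigma>^2) + of_real E * (2 * of_real \<kappa> / \<phi> - of_real (\<sigma>^2)) = 2 * of_real \<kappa> * w / \<phi>"
    and "G_sol T \<kappa> \<sigma> \<phi> t = \<phi> / w"
proof -
  have E: "E \<ge> 1" using assms by (simp add: E_def)
  have "Re w - 1 = (E - 1) * (1 - \<sigma>^2 / (2 * \<kappa>) * Re \<phi>)"
    by (simp add: w_def algebra_simps)
  moreover have "\<sigma>^2 / (2 * \<kappa>) * Re \<phi> \<le> 1"
    using assms by (simp add: field_simps)
  ultimately show w: "Re w \<ge> 1"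
    using E by (metis diff_ge_0_iff_ge mult_nonneg_nonneg)
  have nz: "\<phi> \<noteq> 0" "complex_of_real \<kappa> \<noteq> 0" using assms by auto
  show *: "of_real (\<sigma>^2) + of_real E * (2 * of_real \<kappa> / \<phi> - of_real (\<sigma>^2)) = 2 * of_real \<kappa> * w / \<phi>"
    using nz unfolding w_def by (simp add: field_simps)
  have "w \<noteq> 0" using w by auto
  then show "G_sol T \<kappa> \<sigma> \<phi> t = \<phi> / w"
    unfolding G_sol_def E_def[symmetric] * using nz by simp
qed

text \<open>In Re(z/w) = (Re z Re w + Im z Im w) / |w|^2 the second summand is nonpositive, and Re w
  is at most (Re w)^2, hence at most |w|^2.\<close>

lemma Re_divide_le_Re:
  fixes z w :: complex
  assumes "0 \<le> Re z" "1 \<le> Re w" "Im z * Im w \<le> 0"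
  shows "Re (z / w) \<le> Re z"
proof -
  have "0 < (Re w)^2 + (Im w)^2"
    using assms(2) by (intro add_pos_nonneg) auto
  moreover have "Re z * Re w \<le> Re z * ((Re w)^2 + (Im w)^2)"
    using assms(1,2) self_le_power[of "Re w" 2] by (intro mult_left_mono) (auto intro: add_increasing2)
  ultimately show ?thesis
    using assms(3) by (simp add: complex_div_gt_0 Re_divide divide_le_eq)
qed

lemma Re_G_sol_le:
  assumes "\<kappa> > 0" "\<sigma> > 0" "0 < Re \<phi>" "Re \<phi> < 2 * \<kappa> / \<sigma>^2" "t \<le> T"
  shows "Re (G_sol T \<kappa> \<sigma> \<phi> t) \<le> Re \<phi>"
proof -
  note G = G_sol_denominator[OF assms]
  \<comment> \<open>Im w is -\<sigma>^2 / (2 \<kappa>) (E - 1) Im \<phi>, so its product with Im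
    \<phi> is minus this quantity.\<close>
  have "0 \<le> \<sigma>^2 / (2 * \<kappa>) * (exp (\<kappa> * (T - t)) - 1) * (Im \<phi>)^2"
    using assms by (intro mult_nonneg_nonneg) auto
  then have "Im \<phi> * Im (of_real (exp (\<kappa> * (T - t)))
      - of_real (\<sigma>^2 / (2 * \<kappa>) * (exp (\<kappa> * (T - t)) - 1)) * \<phi>) \<le> 0"
    by (simp add: power2_eq_square mult_ac)
  then show ?thesis
    unfolding G(3) by (intro Re_divide_le_Re G(1)) (use assms in auto)
qed

lemma G_sol_solves:
  assumes "\<kappa> > 0" "\<sigma> > 0" "0 < Re \<phi>" "Re \<phi> < 2 * \<kappa> / \<sigma>^2"
  shows "solves_tvp T (ode_G \<kappa> \<sigma>) \<phi> (G_sol T \<kappa> \<sigma> \<phi>)"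
  unfolding solves_tvp_def
proof (intro conjI ballI)
  show "G_sol T \<kappa> \<sigma> \<phi> T = \<phi>"
    using assms by (auto simp: G_sol_def)
  fix t assume t: "t \<in> {0..T}"
  define e where "e s = complex_of_real (exp (\<kappa> * (T - s)))" for s
  define A where "A = 2 * complex_of_real \<kappa> / \<phi> - complex_of_real (\<sigma>^2)"
  define d where "d s = complex_of_real (\<sigma>^2) + e s * A" for s
  have dnz: "d t \<noteq> 0"
  proof -
    have "t \<le> T" using t by simp
    note G = G_sol_denominator[OF assms this]
    show ?thesis
      unfolding d_def e_def A_def G(2) using G(1) assms
      by (metis divide_eq_0_iff mult_eq_0_iff not_one_le_zero of_real_eq_0_iff order_less_irrefl
          zero_complex.simps(1) zero_neq_numeral)
  qed
  have Gd: "G_sol T \<kappa> \<sigma> \<phi> s = 2 * complex_of_real \<kappa> / d s" for s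
    by (simp add: G_sol_def d_def e_def A_def)
  have "((\<lambda>s. 2 * of_real \<kappa> / d s) has_vector_derivative
      2 * of_real \<kappa> * (of_real \<kappa> * e t * A / (d t)^2)) (at t within {0..T})"
  proof -
    \<comment> \<open>The denominator is extended to an entire function, differentiated by the
      complex rules, and restricted to real times again.\<close>
    define f where "f z = of_real (\<sigma>^2) + exp (of_real \<kappa> * (of_real T - z)) * A" for z
    have fd: "f (of_real s) = d s" for s
      by (simp add: f_def d_def e_def exp_of_real[symmetric])
    have "(f has_field_derivative - of_real \<kappa> * e t * A) (at (of_real t))"
      unfolding f_def by (auto intro!: derivative_eq_intros simp: e_def exp_of_real[symmetric])
    then have "((\<lambda>z. 2 * of_real \<kappa> / f z) has_field_derivative
        2 * of_real \<kappa> * (of_real \<kappa> * e t * A / (d t)^2)) (at (of_real t))"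
      using dnz by (auto intro!: derivative_eq_intros simp: fd power2_eq_square)
    then show ?thesis
      unfolding fd[symmetric] by (rule has_vector_derivative_real_field)
  qed
  moreover have "ode_G \<kappa> \<sigma> t (G_sol T \<kappa> \<sigma> \<phi> t) (2 * of_real \<kappa> * (of_real \<kappa> * e t * A / (d t)^2))"
  proof -
    \<comment> \<open>Eliminating the exponential turns the differential equation into a rational
      identity in \<open>d t\<close>.\<close>
    have eA: "e t * A = d t - of_real (\<sigma>^2)" by (simp add: d_def)
    show ?thesis
      unfolding ode_G_def Gd using dnz
      by (simp add: mult.assoc eA) (simp add: field_simps power2_eq_square)
  qed
  ultimately show "\<exists>y'. (G_sol T \<kappa> \<sigma> \<phi> has_vector_derivative y') (at t within {0..T}) \<and>
      ode_G \<kappa> \<sigma> t (G_sol T \<kappa> \<sigma> \<phi> t) y'"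
    unfolding Gd[abs_def] by blast
qed

lemma G_sol_unique:
  assumes "solves_tvp T (ode_G \<kappa> \<sigma>) \<phi> y" "solves_tvp T (ode_G \<kappa> \<sigma>) \<phi> z" "t \<in> {0..T}"
  shows "z t = y t"
proof (rule solves_tvp_unique[OF assms(1,2) _ _ assms(3)])
  fix R :: real
  define f where "f = (\<lambda>x::complex. of_real \<kappa> * x - 1/2 * of_real (\<sigma>^2) * x^2)"
  show "ode_G \<kappa> \<sigma> t x x' \<longleftrightarrow> x' = f x" for t x x'
    unfolding ode_G_def f_def by (auto simp: algebra_simps)
  have "(\<bar>\<kappa>\<bar> + \<sigma>^2 * \<bar>R\<bar>)-lipschitz_on (cball 0 R) f"
  proof (rule lipschitz_onI)
    fix x y :: complex assume "x \<in> cball 0 R" "y \<in> cball 0 R"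
    then show "dist (f x) (f y) \<le> (\<bar>\<kappa>\<bar> + \<sigma>^2 * \<bar>R\<bar>) * dist x y"
      unfolding dist_norm
    proof (intro field_differentiable_bound[where S = "cball 0 R" and f' = "\<lambda>x. of_real \<kappa> - of_real (\<sigma>^2) * x"])
      fix z :: complex assume z: "z \<in> cball 0 R"
      show "(f has_field_derivative of_real \<kappa> - of_real (\<sigma>^2) * z) (at z within cball 0 R)"
        unfolding f_def by (auto intro!: derivative_eq_intros)
      have "norm (of_real \<kappa> - of_real (\<sigma>^2) * z) \<le> \<bar>\<kappa>\<bar> + \<sigma>^2 * norm z"
        by (rule order_trans[OF norm_triangle_ineq4]) (simp add: norm_mult norm_power)
      also have "\<dots> \<le> \<bar>\<kappa>\<bar> + \<sigma>^2 * \<bar>R\<bar>"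
        using z by (intro add_left_mono mult_left_mono) auto
      finally show "norm (of_real \<kappa> - of_real (\<sigma>^2) * z) \<le> \<bar>\<kappa>\<bar> + \<sigma>^2 * \<bar>R\<bar>" .
    qed auto
  qed auto
  then show "\<exists>C. \<forall>t\<in>{0..T}. C-lipschitz_on (cball 0 R) f" by blast
qed

section \<open>The equation for H\<close>

lemma exp_of_real_mult_lipschitz_on:
  "(exp (\<bar>\<alpha>\<bar> * \<bar>R\<bar>) * \<bar>\<alpha>\<bar>)-lipschitz_on (cball 0 R) (\<lambda>x::complex. exp (of_real \<alpha> * x))"
proof -
  have "(exp (\<bar>\<alpha>\<bar> * \<bar>R\<bar>))-lipschitz_on ((\<lambda>x. of_real \<alpha> * x) ` cball 0 R) (exp :: complex \<Rightarrow> complex)"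
  proof (rule lipschitz_on_subset[OF lipschitz_on_exp_halfplane], safe)
    fix x :: complex assume "x \<in> cball 0 R"
    then have "\<bar>\<alpha>\<bar> * norm x \<le> \<bar>\<alpha>\<bar> * \<bar>R\<bar>"
      by (intro mult_left_mono) auto
    then show "Re (of_real \<alpha> * x) \<le> \<bar>\<alpha>\<bar> * \<bar>R\<bar>"
      using complex_Re_le_cmod[of "of_real \<alpha> * x"] by (simp add: norm_mult)
  qed
  moreover have "\<bar>\<alpha>\<bar>-lipschitz_on (cball 0 R) (\<lambda>x::complex. of_real \<alpha> * x)"
    by (rule lipschitz_onI) (auto simp: dist_norm norm_mult simp flip: right_diff_distrib)
  ultimately show ?thesis
    by (rule lipschitz_on_compose2[rotated])
qed

text \<open>The factor \<open>g\<close> is left open to serve twice: as the capped exponential on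
  the whole plane for existence, and as the true exponential on balls for uniqueness.\<close>

lemma exp_ode_lipschitz:
  fixes m :: "real \<Rightarrow> complex" and g :: "complex \<Rightarrow> complex"
  assumes "C-lipschitz_on S g" and "norm (m t) \<le> m\<^sub>0"
  shows "(\<bar>\<beta>\<bar> + C * m\<^sub>0)-lipschitz_on S (\<lambda>x. of_real \<beta> * x - g x * m t + 1)"
proof (rule lipschitz_onI)
  have "C \<ge> 0" using assms(1) by (rule lipschitz_on_nonneg)
  have "m\<^sub>0 \<ge> 0" using norm_ge_zero[of "m t"] assms(2) by linarith
  then show "0 \<le> \<bar>\<beta>\<bar> + C * m\<^sub>0" using \<open>C \<ge> 0\<close> by simp
  fix x y assume xy: "x \<in> S" "y \<in> S"
  have "dist (of_real \<beta> * x - g x * m t + 1) (of_real \<beta> * y - g y * m t + 1) =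
      norm (of_real \<beta> * (x - y) - (g x - g y) * m t)"
    by (simp add: dist_norm algebra_simps)
  also have "\<dots> \<le> \<bar>\<beta>\<bar> * dist x y + dist (g x) (g y) * norm (m t)"
    by (rule order_trans[OF norm_triangle_ineq4]) (simp add: norm_mult dist_norm)
  also have "\<dots> \<le> \<bar>\<beta>\<bar> * dist x y + (C * dist x y) * m\<^sub>0"
    using lipschitz_onD[OF assms(1) xy] assms(2) \<open>C \<ge> 0\<close> by (intro add_left_mono mult_mono) auto
  finally show "dist (of_real \<beta> * x - g x * m t + 1) (of_real \<beta> * y - g y * m t + 1) \<le>
      (\<bar>\<beta>\<bar> + C * m\<^sub>0) * dist x y"
    by (simp add: algebra_simps)
qed

text \<open>The map is the nearest-point projection onto the half-plane Re z \<le> u, hence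
  nonexpansive.\<close>

lemma lipschitz_on_Re_truncation:
  "1-lipschitz_on UNIV (\<lambda>z. Complex (min (Re z) u) (Im z))"
proof (rule lipschitz_onI)
  fix x y :: complex
  have "\<bar>min (Re x) u - min (Re y) u\<bar> \<le> \<bar>Re x - Re y\<bar>"
    by (auto simp: min_def)
  then show "dist (Complex (min (Re x) u) (Im x)) (Complex (min (Re y) u) (Im y)) \<le> 1 * dist x y"
    by (auto simp: dist_norm cmod_def power2_le_iff_abs_le abs_le_square_iff intro!: real_sqrt_le_mono)
qed simp

text \<open>At \<open>u = 1 / \<alpha> - 1 / \<beta>\<close> the function \<open>\<beta> * x - exp (\<alpha> * x) * c + 1\<close>, with \<open>c\<close> the critical
  value \<open>\<beta> / \<alpha> * exp (\<alpha> / \<beta> - 1)\<close>, has a double zero; hence the real part of a solution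
  cannot cross \<open>u\<close> when going backwards in time, and truncating it at \<open>u\<close> is harmless.\<close>

lemma exp_ode_terminal_solution:
  fixes m :: "real \<Rightarrow> complex"
  assumes "T \<ge> 0" "0 < \<alpha>" "0 < \<beta>"
    and m_cont: "continuous_on {0..T} m"
    and m_le: "\<And>t. t \<in> {0..T} \<Longrightarrow> norm (m t) \<le> m\<^sub>0"
    and m\<^sub>0: "m\<^sub>0 < \<beta> / \<alpha> * exp (\<alpha> / \<beta> - 1)"
    and \<psi>: "Re \<psi> < (\<beta> - \<alpha>) / (\<alpha> * \<beta>)"
  obtains y where "\<And>t. t \<in> {0..T} \<Longrightarrow>
      (y has_vector_derivative of_real \<beta> * y t - exp (of_real \<alpha> * y t) * m t + 1) (at t within {0..T})"
    and "y T = \<psi>"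
proof -
  define u where "u = (\<beta> - \<alpha>) / (\<alpha> * \<beta>)"
  define P where "P z = Complex (min (Re z) u) (Im z)" for z
  define g where "g z = exp (of_real \<alpha> * P z)" for z
  have P_lip: "1-lipschitz_on UNIV P"
    unfolding P_def[abs_def] by (rule lipschitz_on_Re_truncation)
  have "(\<alpha> * 1)-lipschitz_on UNIV (\<lambda>z. of_real \<alpha> * P z)"
  proof (rule lipschitz_onI)
    fix x y
    show "dist (of_real \<alpha> * P x) (of_real \<alpha> * P y) \<le> (\<alpha> * 1) * dist x y"
      using lipschitz_onD[OF P_lip, of x y] \<open>0 < \<alpha>\<close>
      by (simp add: dist_norm norm_mult flip: right_diff_distrib)
  qed (use \<open>0 < \<alpha>\<close> in simp)
  then have "(exp (\<alpha> * u) * (\<alpha> * 1))-lipschitz_on UNIV (\<lambda>z. exp (of_real \<alpha> * P z))"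
  proof (rule lipschitz_on_compose2)
    show "(exp (\<alpha> * u))-lipschitz_on (range (\<lambda>z. of_real \<alpha> * P z)) (exp :: complex \<Rightarrow> complex)"
      by (rule lipschitz_on_subset[OF lipschitz_on_exp_halfplane])
        (use \<open>0 < \<alpha>\<close> in \<open>auto simp: P_def\<close>)
  qed
  then have g_lip: "(exp (\<alpha> * u) * (\<alpha> * 1))-lipschitz_on UNIV g"
    by (simp add: g_def[abs_def])
  define f where "f t x = of_real \<beta> * x - g x * m t + 1" for t x
  have "continuous_on ({0..T} \<times> UNIV) (\<lambda>(t, x). f t x)"
    unfolding f_def case_prod_unfold
    by (intro continuous_intros continuous_on_compose2[OF m_cont]
        continuous_on_compose2[OF lipschitz_on_continuous_on[OF g_lip]]) auto
  then obtain y where y: "\<And>t. t \<in> {0..T} \<Longrightarrow> (y has_vector_derivative f t (y t)) (at t within {0..T})"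
    and yT: "y T = \<psi>"
    using global_lipschitz_terminal_solution[of 0 T f _ \<psi>] exp_ode_lipschitz[OF g_lip m_le] \<open>T \<ge> 0\<close>
    unfolding f_def by (metis (no_types, lifting))
  \<comment> \<open>At u the two sides of the critical comparison are both \<beta>/\<alpha>; the
    strict bound on \<open>m\<^sub>0\<close> makes it strict.\<close>
  have crit: "exp (\<alpha> * u) * m\<^sub>0 < \<beta> * u + 1"
  proof -
    have \<alpha>u: "\<alpha> * u = 1 - \<alpha> / \<beta>" and \<beta>u: "\<beta> * u + 1 = \<beta> / \<alpha>"
      using assms by (simp_all add: u_def field_simps)
    have "exp (1 - \<alpha> / \<beta>) * m\<^sub>0 < exp (1 - \<alpha> / \<beta>) * (\<beta> / \<alpha> * exp (\<alpha> / \<beta> - 1))"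
      using m\<^sub>0 by (intro mult_strict_left_mono) auto
    also have "\<dots> = \<beta> / \<alpha> * exp ((1 - \<alpha> / \<beta>) + (\<alpha> / \<beta> - 1))"
      unfolding exp_add by (simp only: mult_ac)
    finally show ?thesis
      by (simp add: \<alpha>u \<beta>u)
  qed
  have less: "Re (y t) < u" if "t \<in> {0..T}" for t
  proof (rule ccontr)
    assume "\<not> Re (y t) < u"
    \<comment> \<open>At the last time s with Re y(s) \<ge> u, which precedes T by the bound on Re
      \<psi>, the derivative of Re y turns out positive. Then Re y stays above u just after s,
      contradicting the choice of s.\<close>
    define S where "S = {s \<in> {0..T}. u \<le> Re (y s)}"
    have "continuous_on {0..T} y"
      unfolding continuous_on_eq_continuous_within
      using y by (blast intro: has_vector_derivative_continuous)
    then have "continuous_on {0..T} (\<lambda>s. Re (y s))"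
      by (intro continuous_intros)
    then have "closed ({0..T} \<inter> (\<lambda>s. Re (y s)) -` {u..})"
      by (intro continuous_closed_preimage) auto
    then have "compact ({0..T} \<inter> ({0..T} \<inter> (\<lambda>s. Re (y s)) -` {u..}))"
      by (intro compact_Int_closed) auto
    moreover have "{0..T} \<inter> ({0..T} \<inter> (\<lambda>s. Re (y s)) -` {u..}) = S"
      by (auto simp: S_def)
    ultimately have "compact S" by simp
    moreover have "S \<noteq> {}"
      using that \<open>\<not> Re (y t) < u\<close> by (auto simp: S_def)
    ultimately obtain s where s: "s \<in> S" and max: "\<And>r. r \<in> S \<Longrightarrow> r \<le> s"
      using compact_attains_sup[of S] by blast
    have s_in: "s \<in> {0..T}" and s_ge: "u \<le> Re (y s)" using s by (auto simp: S_def)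
    have "s \<noteq> T" using s_ge yT \<psi> by (auto simp: u_def)
    then have "s < T" using s_in by simp
    have "Re (g (y s) * m s) \<le> norm (g (y s) * m s)"
      by (rule complex_Re_le_cmod)
    \<comment> \<open>Since Re y(s) \<ge> u, the cap is active and \<open>g (y s)\<close> has
      modulus exactly exp(\<alpha> u), however large Re y(s) is.\<close>
    also have "\<dots> \<le> exp (\<alpha> * u) * m\<^sub>0"
      using m_le[OF s_in] s_ge by (simp add: norm_mult g_def P_def mult_left_mono)
    also have "\<dots> < \<beta> * u + 1" by (rule crit)
    also have "\<dots> \<le> \<beta> * Re (y s) + 1"
      using s_ge \<open>0 < \<beta>\<close> by simp
    finally have pos: "0 < Re (f s (y s))" by (simp add: f_def)
    have "((\<lambda>t. Re (y t)) has_real_derivative Re (f s (y s))) (at s within {0..T})"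
      unfolding has_real_derivative_iff_has_vector_derivative
      by (rule bounded_linear.has_vector_derivative[OF bounded_linear_Re y[OF s_in]])
    from has_real_derivative_pos_inc_right[OF this pos]
    obtain d where d: "d > 0" "\<And>h. 0 < h \<Longrightarrow> s + h \<in> {0..T} \<Longrightarrow> h < d \<Longrightarrow> Re (y s) < Re (y (s + h))"
      by blast
    define h where "h = min (d / 2) (T - s)"
    have h: "0 < h" "h < d" "s + h \<in> {0..T}"
      using d(1) \<open>s < T\<close> s_in by (auto simp: h_def min_def)
    then have "s + h \<in> S"
      using d(2)[of h] s_ge by (auto simp: S_def)
    then show False using max[of "s + h"] h(1) by simp
  qed
  show thesis
  proof (rule that[of y])
    fix t assume t: "t \<in> {0..T}"
    have "P (y t) = y t"
      using less[OF t] by (simp add: P_def complex_eq_iff)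
    then show "(y has_vector_derivative of_real \<beta> * y t - exp (of_real \<alpha> * y t) * m t + 1) (at t within {0..T})"
      using y[OF t] by (simp add: f_def g_def)
  qed (rule yT)
qed

section \<open>The equation for F and the five claims\<close>

lemma unique_solution_antiderivative:
  fixes g :: "real \<Rightarrow> complex"
  assumes "continuous_on {0..T} g" and "\<And>t y y'. ode t y y' \<longleftrightarrow> y' = g t"
  shows "\<exists>y. unique_solution_tvp T ode 0 y"
proof -
  have sol: "solves_tvp T ode 0 (\<lambda>t. - integral {t..T} g)"
    unfolding solves_tvp_def
  proof (intro conjI ballI)
    fix t assume "t \<in> {0..T}"
    then have "((\<lambda>t. - integral {t..T} g) has_vector_derivative - (- g t)) (at t within {0..T})"
      by (intro has_vector_derivative_minus integral_has_vector_derivative'[OF assms(1)])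
    then show "\<exists>y'. ((\<lambda>t. - integral {t..T} g) has_vector_derivative y') (at t within {0..T}) \<and>
        ode t (- integral {t..T} g) y'"
      by (auto simp: assms(2))
  qed simp
  have "\<exists>C. \<forall>t\<in>{0..T}. C-lipschitz_on (cball 0 R) (\<lambda>_. g t)" for R :: real
    by (auto intro!: exI[of _ 0] lipschitz_intros)
  then have "z t = - integral {t..T} g" if "solves_tvp T ode 0 z" "t \<in> {0..T}" for z t
    by (rule solves_tvp_unique[where f = "\<lambda>t _. g t", OF sol that(1) assms(2) _ that(2)])
  with sol show ?thesis
    unfolding unique_solution_tvp_def by blast
qed

text \<open>Boundedness and integrability are stated next to suprema and integrals, because a real
  \<open>SUP\<close> is unspecified on unbounded sets and the Bochner integral defaults to 0. Claim
  (v) ranges over every solution \<open>H\<close>: by (iv) these agree on [0,T] and differ at most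
  outside it.\<close>

theorem lemma5p3:
  fixes M :: "'w measure"
    and B W v S :: "real \<Rightarrow> 'w \<Rightarrow> real"
    and N :: "real \<Rightarrow> 'w \<Rightarrow> nat"
    and J :: "nat \<Rightarrow> 'w \<Rightarrow> real"
    and L :: "real \<Rightarrow> 'w \<Rightarrow> real"
    and F :: "real \<Rightarrow> 'w measure"
    and \<mu> :: "real \<Rightarrow> real"
    and T lam\<^sub>0 \<alpha> \<beta> \<epsilon>\<^sub>J r S\<^sub>0 v\<^sub>0 \<kappa> vbar \<sigma> \<eta> \<rho> cl D \<epsilon>\<^sub>1 \<epsilon>\<^sub>2 Q\<^sub>1 Q\<^sub>2 a \<kappa>\<^sub>a vbar\<^sub>a :: real
    and Q :: "'w measure"
    and \<phi> \<psi> :: complex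
    and G :: "real \<Rightarrow> complex"
  assumes "T > 0"
    and "prob_space M" and "complete_measure M"
    and "brownian_motion_2d M T B W"
    and "lam\<^sub>0 > 0" and "\<beta> > 0" and "0 < \<alpha>" and "\<alpha> < \<beta>"
    and "hawkes_process M T lam\<^sub>0 \<alpha> \<beta> N"
    and "prob_space.indep_vars M (\<lambda>_. borel) J {1..}"
    and "\<And>i. i \<ge> 1 \<Longrightarrow> distr M borel (J i) = distr M borel (J 1)"
    and "\<And>i. i \<ge> 1 \<Longrightarrow> AE \<omega> in M. J i \<omega> > 0"
    and "\<And>i. i \<ge> 1 \<Longrightarrow> integrable M (J i)"
    and "prob_space.indep_sets M
           ((!) [sets (gen_sigma M (\<lambda>t \<omega>. (B t \<omega>, W t \<omega>)) {0..T}),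
                 sets (gen_sigma M N {0..T}),
                 sets (gen_sigma M J {1..})]) {..<3}"
    and "L = compound_process N J"
    and "\<epsilon>\<^sub>J > 0"
    and "\<And>t. t < \<epsilon>\<^sub>J \<Longrightarrow> integrable M (\<lambda>\<omega>. exp (t * J 1 \<omega>))"
    and "filterlim (mgf M (J 1)) at_top (at_left \<epsilon>\<^sub>J)"
    and "F = market_filtration M B W L"
    and "S\<^sub>0 > 0" and "v\<^sub>0 > 0" and "\<kappa> > 0" and "vbar > 0" and "\<sigma> > 0" and "\<eta> > 0"
    and "bounded (\<mu> ` {0..T})" and "set_borel_measurable borel {0..T} \<mu>"
    and "-1 < \<rho>" and "\<rho> < 1"
    and "2 * \<kappa> * vbar \<ge> \<sigma>^2"
    and "variance_process M F T v\<^sub>0 \<kappa> vbar \<sigma> \<eta> W L v"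
    and "stock_process M F T S\<^sub>0 \<mu> \<rho> B W v S"
    and "cl = c_l M (J 1) \<epsilon>\<^sub>J T \<alpha> \<beta> \<kappa> \<sigma> \<eta>"
    and "D = (SUP t\<in>{0..T}. (\<mu> t - r)^2)"
    and "\<epsilon>\<^sub>1 > 0" and "\<epsilon>\<^sub>2 > 0"
    and "\<rho>^2 < cl"
    (* ereal division: the bound is infinite if D = 0 *)
    and "1 < ereal (1 - \<rho>^2) / ereal (D * ((2 + \<epsilon>\<^sub>1)^2 - (2 + \<epsilon>\<^sub>1)))
               * ereal (((2 * \<kappa> * vbar - \<sigma>^2) / (2 * \<sigma>))^2)"
    and "2 * \<kappa> * vbar > (1 + \<epsilon>\<^sub>2) * \<sigma>^2"
    and "1 < Q\<^sub>2"
    and "ereal Q\<^sub>2 < ereal (1 - \<rho>^2) / ereal (D * ((2 + \<epsilon>\<^sub>1)^2 - (2 + \<epsilon>\<^sub>1)))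
                      * ereal (((2 * \<kappa> * vbar - \<sigma>^2) / (2 * \<sigma>))^2)"
    and "Q\<^sub>1 = Q\<^sub>2 / (Q\<^sub>2 - 1)"
    and "(a, Q) \<in> E_m M F T \<mu> r \<rho> B W v cl Q\<^sub>1 (2 + \<epsilon>\<^sub>1)"
    and "\<kappa>\<^sub>a = \<kappa> + a * \<sigma>"
    and "vbar\<^sub>a = \<kappa> * vbar / (\<kappa> + a * \<sigma>)"
    and "0 < Re \<phi>"
    and "Re \<phi> < min (2 * \<kappa>\<^sub>a / (\<sigma>^2 * (2 * exp (\<kappa>\<^sub>a * T) - 1))) (L_J M (J 1) \<epsilon>\<^sub>J \<alpha> \<beta> \<eta>)"
    and "Re \<psi> < (\<beta> - \<alpha>) / (\<alpha> * \<beta>)"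
    and "G = G_sol T \<kappa>\<^sub>a \<sigma> \<phi>"
  shows
    \<comment> \<open>(i)\<close>
    "unique_solution_tvp T (ode_G \<kappa>\<^sub>a \<sigma>) \<phi> G \<and>
    \<comment> \<open>(ii)\<close>
     (bdd_above ((\<lambda>t. Re (G t)) ` {0..T}) \<and>
      (SUP t\<in>{0..T}. Re (G t)) = Re \<phi>) \<and>
    \<comment> \<open>(iii)\<close>
     ((\<forall>t\<in>{0..T}. integrable M (\<lambda>\<omega>. exp (\<eta> * Re (G t) * J 1 \<omega>))) \<and>
      bdd_above ((\<lambda>t. \<integral>\<omega>. exp (\<eta> * Re (G t) * J 1 \<omega>) \<partial>M) ` {0..T}) \<and>
      (SUP t\<in>{0..T}. \<integral>\<omega>. exp (\<eta> * Re (G t) * J 1 \<omega>) \<partial>M) < \<beta> / \<alpha> * exp (\<alpha> / \<beta> - 1) \<and>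
      (\<forall>t\<in>{0..T}. integrable M
         (\<lambda>\<omega>. exp (complex_of_real \<eta> * G t * complex_of_real (J 1 \<omega>))))) \<and>
    \<comment> \<open>(iv)\<close>
     (\<exists>H. unique_solution_tvp T (ode_H M (J 1) \<alpha> \<beta> \<eta> G) \<psi> H) \<and>
    \<comment> \<open>(v)\<close>
     (\<forall>H. solves_tvp T (ode_H M (J 1) \<alpha> \<beta> \<eta> G) \<psi> H \<longrightarrow>
         (\<exists>Fa. unique_solution_tvp T (ode_F \<kappa>\<^sub>a vbar\<^sub>a \<beta> lam\<^sub>0 G H) 0 Fa))"
proof -
  interpret prob_space M by fact
  define m where "m t = (\<integral>\<omega>. exp (complex_of_real \<eta> * G t * complex_of_real (J 1 \<omega>)) \<partial>M)" for t
  define y where "y = \<beta> / \<alpha> * exp (\<alpha> / \<beta> - 1)"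
  define \<tau> where "\<tau> = the_inv_into {..<\<epsilon>\<^sub>J} (mgf M (J 1)) y"
  have "integrable M (J 1)" and J_pos: "AE \<omega> in M. J 1 \<omega> > 0"
    using \<open>\<And>i. i \<ge> 1 \<Longrightarrow> integrable M (J i)\<close> \<open>\<And>i. i \<ge> 1 \<Longrightarrow> AE \<omega> in M. J i \<omega> > 0\<close> by auto
  then have J_meas [measurable]: "J 1 \<in> borel_measurable M" by auto
  note int = \<open>\<And>t. t < \<epsilon>\<^sub>J \<Longrightarrow> integrable M (\<lambda>\<omega>. exp (t * J 1 \<omega>))\<close>

  have "\<kappa>\<^sub>a > 0"
  proof -
    \<comment> \<open>From \<open>cl\<close> \<le> \<kappa>^2 / (2 \<sigma>^2) follows sqrt(2
      \<open>cl\<close>) \<le> \<kappa>/\<sigma>; as |a| is below half of that root, |a| \<sigma> <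
      \<kappa>/2.\<close>
    have "sqrt (2 * cl) \<le> sqrt ((\<kappa> / \<sigma>)^2)"
    proof (rule real_sqrt_le_mono)
      have "cl \<le> \<kappa>^2 / (2 * \<sigma>^2)"
        unfolding \<open>cl = c_l M (J 1) \<epsilon>\<^sub>J T \<alpha> \<beta> \<kappa> \<sigma> \<eta>\<close> by (rule c_l_le) fact+
      then show "2 * cl \<le> (\<kappa> / \<sigma>)^2" by (simp add: power_divide)
    qed
    moreover have "\<bar>a\<bar> < sqrt (2 * cl) / 2"
      using \<open>(a, Q) \<in> E_m M F T \<mu> r \<rho> B W v cl Q\<^sub>1 (2 + \<epsilon>\<^sub>1)\<close> by (simp add: E_m_def)
    ultimately have "\<bar>a\<bar> < \<kappa> / \<sigma> / 2"
      using \<open>\<kappa> > 0\<close> \<open>\<sigma> > 0\<close> by simp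
    then have "- a * \<sigma> < \<kappa> / \<sigma> / 2 * \<sigma>"
      using \<open>\<sigma> > 0\<close> by (intro mult_strict_right_mono) auto
    then show ?thesis
      using \<open>\<kappa> > 0\<close> \<open>\<sigma> > 0\<close> by (simp add: \<open>\<kappa>\<^sub>a = \<kappa> + a * \<sigma>\<close>)
  qed

  have \<phi>_less: "Re \<phi> < 2 * \<kappa>\<^sub>a / \<sigma>^2"
  proof -
    have "1 \<le> 2 * exp (\<kappa>\<^sub>a * T) - 1"
      using \<open>\<kappa>\<^sub>a > 0\<close> \<open>T > 0\<close> by simp
    then have "2 * \<kappa>\<^sub>a / (\<sigma>^2 * (2 * exp (\<kappa>\<^sub>a * T) - 1)) \<le> 2 * \<kappa>\<^sub>a / (\<sigma>^2 * 1)"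
      using \<open>\<kappa>\<^sub>a > 0\<close> \<open>\<sigma> > 0\<close> by (intro divide_left_mono mult_left_mono mult_pos_pos) (linarith | simp)+
    then show ?thesis
      using \<open>Re \<phi> < min (2 * \<kappa>\<^sub>a / (\<sigma>^2 * (2 * exp (\<kappa>\<^sub>a * T) - 1))) (L_J M (J 1) \<epsilon>\<^sub>J \<alpha> \<beta> \<eta>)\<close>
      by simp
  qed
  have G_sol: "solves_tvp T (ode_G \<kappa>\<^sub>a \<sigma>) \<phi> G"
    unfolding \<open>G = G_sol T \<kappa>\<^sub>a \<sigma> \<phi>\<close> by (rule G_sol_solves) fact+
  then have GT: "G T = \<phi>" and G_cont: "continuous_on {0..T} G"
    by (auto simp: solves_tvp_def intro: solves_tvp_continuous_on)
  have Re_G: "Re (G t) \<le> Re \<phi>" if "t \<in> {0..T}" for t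
    unfolding \<open>G = G_sol T \<kappa>\<^sub>a \<sigma> \<phi>\<close> 
    by (rule Re_G_sol_le[OF \<open>\<kappa>\<^sub>a > 0\<close> \<open>\<sigma> > 0\<close> \<open>0 < Re \<phi>\<close> \<phi>_less]) (use that in simp)
  \<comment> \<open>Both suprema are attained at T, where G equals \<phi>.\<close>
  have sup: "(SUP t\<in>{0..T}. f t) = f T" "bdd_above (f ` {0..T})"
    if "\<And>t. t \<in> {0..T} \<Longrightarrow> f t \<le> f T" for f :: "real \<Rightarrow> real"
    using that \<open>T > 0\<close> by (auto intro!: cSup_eq_maximum bdd_aboveI2[where M = "f T"])

  have "1 \<le> y"
    using exp_minus_one_ge[of "\<alpha> / \<beta>"] \<open>0 < \<alpha>\<close> \<open>\<beta> > 0\<close> by (simp add: y_def field_simps)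
  have \<tau>: "\<tau> < \<epsilon>\<^sub>J" "mgf M (J 1) \<tau> = y"
    unfolding \<tau>_def
    using mgf_the_inv_into[OF J_meas J_pos int \<open>filterlim (mgf M (J 1)) at_top (at_left \<epsilon>\<^sub>J)\<close>
      \<open>\<epsilon>\<^sub>J > 0\<close> \<open>1 \<le> y\<close>] by blast+
  have \<phi>_\<tau>: "\<eta> * Re \<phi> < \<tau>"
    using \<open>Re \<phi> < min (2 * \<kappa>\<^sub>a / (\<sigma>^2 * (2 * exp (\<kappa>\<^sub>a * T) - 1))) (L_J M (J 1) \<epsilon>\<^sub>J \<alpha> \<beta> \<eta>)\<close> \<open>\<eta> > 0\<close>
    by (simp add: L_J_def \<tau>_def y_def field_simps)
  have \<eta>G: "\<eta> * Re (G t) \<le> \<eta> * Re \<phi>" if "t \<in> {0..T}" for t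
    using Re_G[OF that] \<open>\<eta> > 0\<close> by simp
  have int_G: "integrable M (\<lambda>\<omega>. exp (\<eta> * Re (G t) * J 1 \<omega>))" if "t \<in> {0..T}" for t
    using \<eta>G[OF that] \<phi>_\<tau> \<tau>(1) by (intro int) simp
  have norm_exp: "norm (exp (complex_of_real \<eta> * G t * complex_of_real (J 1 \<omega>))) =
      exp (\<eta> * Re (G t) * J 1 \<omega>)" for t \<omega>
    by simp
  have cG_meas: "(\<lambda>\<omega>. exp (complex_of_real \<eta> * G t * complex_of_real (J 1 \<omega>))) \<in> borel_measurable M" for t
    by measurable
  \<comment> \<open>This one number is the supremum in (iii), attained at T and therefore still
    strictly below \<open>y\<close>, and it is also the uniform bound on |m| for the equation for
    H.\<close>
  have mgf_less: "mgf M (J 1) (\<eta> * Re \<phi>) < y"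
    using mgf_strict_mono[OF J_pos int int \<phi>_\<tau>] \<phi>_\<tau> \<tau> by simp
  have mgf_le: "mgf M (J 1) (\<eta> * Re (G t)) \<le> mgf M (J 1) (\<eta> * Re \<phi>)" if "t \<in> {0..T}" for t
    using mgf_strict_mono[OF J_pos int int, of "\<eta> * Re (G t)" "\<eta> * Re \<phi>"] \<eta>G[OF that] \<phi>_\<tau> \<tau>(1)
    by (cases "\<eta> * Re (G t) = \<eta> * Re \<phi>") auto
  have m_le: "norm (m t) \<le> mgf M (J 1) (\<eta> * Re \<phi>)" if "t \<in> {0..T}" for t
  proof -
    have "norm (m t) \<le> mgf M (J 1) (\<eta> * Re (G t))"
      unfolding m_def mgf_def norm_exp[symmetric] by (rule integral_norm_bound)
    then show ?thesis using mgf_le[OF that] by simp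
  qed
  have m_cont: "continuous_on {0..T} m"
    unfolding m_def[abs_def]
  proof (rule continuous_on_dominated_integral)
    show "integrable M (\<lambda>\<omega>. exp (\<eta> * Re \<phi> * J 1 \<omega>))"
      using \<phi>_\<tau> \<tau>(1) by (intro int) simp
    fix t assume "t \<in> {0..T}"
    show "AE \<omega> in M. norm (exp (complex_of_real \<eta> * G t * complex_of_real (J 1 \<omega>))) \<le> exp (\<eta> * Re \<phi> * J 1 \<omega>)"
      using J_pos unfolding norm_exp
      by eventually_elim (use \<eta>G[OF \<open>t \<in> {0..T}\<close>] in \<open>simp add: mult_right_mono\<close>)
  qed (rule cG_meas, intro continuous_intros G_cont)

  have ode_H: "ode_H M (J 1) \<alpha> \<beta> \<eta> G t x x' \<longleftrightarrow> x' = of_real \<beta> * x - exp (of_real \<alpha> * x) * m t + 1" for t x x'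
    unfolding ode_H_def m_def[symmetric] by (auto simp: algebra_simps)
  have "\<exists>H. solves_tvp T (ode_H M (J 1) \<alpha> \<beta> \<eta> G) \<psi> H"
  proof -
    obtain H where "\<And>t. t \<in> {0..T} \<Longrightarrow>
        (H has_vector_derivative of_real \<beta> * H t - exp (of_real \<alpha> * H t) * m t + 1) (at t within {0..T})"
      and "H T = \<psi>"
      using exp_ode_terminal_solution[of T \<alpha> \<beta> m _ \<psi>, OF _ _ _ m_cont m_le mgf_less[unfolded y_def]]
        \<open>T > 0\<close> \<open>0 < \<alpha>\<close> \<open>\<beta> > 0\<close> \<open>Re \<psi> < (\<beta> - \<alpha>) / (\<alpha> * \<beta>)\<close> by auto
    then show ?thesis
      unfolding solves_tvp_def ode_H by blast
  qed
  \<comment> \<open>Both solutions are arbitrary here, so the Lipschitz bound is taken on balls and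
    not on the invariant half-plane.\<close>
  moreover have "z t = H t" if "solves_tvp T (ode_H M (J 1) \<alpha> \<beta> \<eta> G) \<psi> H"
    "solves_tvp T (ode_H M (J 1) \<alpha> \<beta> \<eta> G) \<psi> z" "t \<in> {0..T}" for H z t
    by (rule solves_tvp_unique[OF that(1,2) ode_H _ that(3)])
      (intro exI ballI, rule exp_ode_lipschitz[OF exp_of_real_mult_lipschitz_on m_le])
  ultimately have H: "\<exists>H. unique_solution_tvp T (ode_H M (J 1) \<alpha> \<beta> \<eta> G) \<psi> H"
    unfolding unique_solution_tvp_def by blast

  have F: "\<exists>Fa. unique_solution_tvp T (ode_F \<kappa>\<^sub>a vbar\<^sub>a \<beta> lam\<^sub>0 G H) 0 Fa"
    if "solves_tvp T (ode_H M (J 1) \<alpha> \<beta> \<eta> G) \<psi> H" for H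
  proof -
    have "continuous_on {0..T} (\<lambda>t. - (of_real (\<kappa>\<^sub>a * vbar\<^sub>a) * G t + of_real (\<beta> * lam\<^sub>0) * H t))"
      by (intro continuous_intros G_cont solves_tvp_continuous_on[OF that])
    moreover have "ode_F \<kappa>\<^sub>a vbar\<^sub>a \<beta> lam\<^sub>0 G H t x x' \<longleftrightarrow>
        x' = - (of_real (\<kappa>\<^sub>a * vbar\<^sub>a) * G t + of_real (\<beta> * lam\<^sub>0) * H t)" for t x x'
      by (simp only: ode_F_def eq_neg_iff_add_eq_0 add.assoc)
    ultimately show ?thesis
      by (rule unique_solution_antiderivative)
  qed

  have int_cG: "integrable M (\<lambda>\<omega>. exp (complex_of_real \<eta> * G t * complex_of_real (J 1 \<omega>)))"
    if "t \<in> {0..T}" for t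
    by (rule Bochner_Integration.integrable_bound[OF int_G[OF that] cG_meas]) (simp only: norm_exp, simp)
  have "unique_solution_tvp T (ode_G \<kappa>\<^sub>a \<sigma>) \<phi> G"
    unfolding unique_solution_tvp_def using G_sol G_sol_unique[OF G_sol] by blast
  moreover have "(SUP t\<in>{0..T}. Re (G t)) = Re \<phi>" "bdd_above ((\<lambda>t. Re (G t)) ` {0..T})"
    using sup[of "\<lambda>t. Re (G t)", unfolded GT, OF Re_G] by simp_all
  moreover have "(SUP t\<in>{0..T}. \<integral>\<omega>. exp (\<eta> * Re (G t) * J 1 \<omega>) \<partial>M) < \<beta> / \<alpha> * exp (\<alpha> / \<beta> - 1)"
    "bdd_above ((\<lambda>t. \<integral>\<omega>. exp (\<eta> * Re (G t) * J 1 \<omega>) \<partial>M) ` {0..T})"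
    using sup[of "\<lambda>t. mgf M (J 1) (\<eta> * Re (G t))", unfolded GT, OF mgf_le] mgf_less
    unfolding y_def[symmetric] mgf_def[symmetric] by simp_all
  ultimately show ?thesis
    using int_G int_cG H F by blast
qed

end
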